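(* Let $\mathcal{H}$ be a normalized complete Pick space. Then the mappings $$\mathcal{M}\mapsto \overline{\mathcal{M}}^{\mathcal{H}\odot\mathcal{H}}, \qquad \mathcal{N}\mapsto \mathcal{N}\cap\mathcal{H}$$ (closure of $\mathcal{M}$ in the norm of $\mathcal{H}\odot\mathcal{H}$, and intersection of $\mathcal{N}$ with $\mathcal{H}$, respectively) are mutually inverse and establish a bijection between the closed multiplier invariant subspaces $\mathcal{M}$ of $\mathcal{H}$ and the closed multiplier invariant subspaces $\mathcal{N}$ of $\mathcal{H}\odot\mathcal{H}$.
   Context: All reproducing kernel Hilbert spaces (RKHS) consist of complex-valued functions on a set $X$ and are assumed separable. Normalized complete Pick space: an RKHS $\mathcal{H}$ on $X$ with kernel $K$ such that there is $z_0\in X$ with $K(z,z_0)=1$ for all $z\in X$, and $\mathcal{H}$ has the complete Pick property: for every finite $Y\subset X$ and all $M,N\in\mathbb{N}$, the restriction map from $N\times M$ matrices of multipliers of $\mathcal{H}$ to $N\times M$ matrices of multipliers of $\mathcal{H}|_Y$ (the RKHS on $Y$ with kernel $K|_{Y\times Y}$) maps the closed unit ball onto the closed unit ball, where matrices carry the operator norm of the induced multiplication operator. Equivalently (Agler--McCarthy, McCullough, Quiggin), there are $d\in\mathbb{N}\cup\{\infty\}$ and $b:X\to\mathbb{B}_d$ with $b(z_0)=0$ and $K(z,w)=\frac{1}{1-\langle b(z),b(w)\rangle}$ for all $z,w \in X$, where $\mathbb{B}_d$ is the open unit ball of $\mathbb{C}^d$ (of $\ell^2$ if $d=\infty$). Either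 description may be taken as the definition. Normalization gives $1=K(\cdot,z_0)\in\mathcal{H}$, so $\mathcal{H}\subset\mathcal{H}\odot\mathcal{H}$. Weak product space: $\mathcal{H}\odot\mathcal{H}$ is the space of functions on $X$ of the form $h=\sum_{n=1}^\infty f_n g_n$ (pointwise) with $f_n,g_n\in\mathcal{H}$ and $\sum_n\|f_n\|\|g_n\|<\infty$, with the norm $\|h\|_{\mathcal{H}\odot\mathcal{H}}=\inf\{\sum_n\|f_n\|\|g_n\| : h=\sum_n f_ng_n\}$; it is a Banach function space. A subspace $\mathcal{M}$ of a Banach function space $\mathcal{B}$ is multiplier invariant if $\varphi f\in\mathcal{M}$ whenever $f\in\mathcal{M}$ and $\varphi$ is a function that multiplies $\mathcal{B}$ into itself. *)

theory Defs
  imports "HOL-Analysis.Analysis" "HOL-Library.Function_Algebras"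
begin

text \<open>
  The set \<open>X\<close> on which the functions live is the universe of the type \<open>'a\<close>. Sums, differences and
  products of functions are the pointwise ones of \<^theory>\<open>HOL-Library.Function_Algebras\<close>.
\<close>

definition fun_scale :: "complex \<Rightarrow> ('a \<Rightarrow> complex) \<Rightarrow> ('a \<Rightarrow> complex)" where
  "fun_scale c f = (\<lambda>x. c * f x)"

global_interpretation cfun: vector_space "fun_scale :: complex \<Rightarrow> ('a \<Rightarrow> complex) \<Rightarrow> ('a \<Rightarrow> complex)"
  by unfold_locales (auto simp: fun_scale_def fun_eq_iff algebra_simps)


subsection \<open>The metric and topology of a normed space of functions\<close>

text \<open>
  The locale \<^locale>\<open>Metric_space\<close> wants nonnegativity and symmetry of the distance for all pairs, also
  those outside the carrier, where norms below are unconstrained; hence the value 0 there.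
\<close>

definition norm_dist ::
    "('a \<Rightarrow> complex) set \<Rightarrow> (('a \<Rightarrow> complex) \<Rightarrow> real) \<Rightarrow> ('a \<Rightarrow> complex) \<Rightarrow> ('a \<Rightarrow> complex) \<Rightarrow> real" where
  "norm_dist S nrm f g = (if f \<in> S \<and> g \<in> S then nrm (f - g) else 0)"

definition norm_topology ::
    "('a \<Rightarrow> complex) set \<Rightarrow> (('a \<Rightarrow> complex) \<Rightarrow> real) \<Rightarrow> ('a \<Rightarrow> complex) topology" where
  "norm_topology S nrm = Metric_space.mtopology S (norm_dist S nrm)"

lemma Metric_space_norm_dist:
  assumes S: "cfun.subspace S"
    and nonneg: "\<And>f. f \<in> S \<Longrightarrow> 0 \<le> nrm f"
    and zero: "\<And>f. f \<in> S \<Longrightarrow> nrm f = 0 \<longleftrightarrow> f = 0"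
    and minus: "\<And>f. f \<in> S \<Longrightarrow> nrm (- f) = nrm f"
    and add: "\<And>f g. f \<in> S \<Longrightarrow> g \<in> S \<Longrightarrow> nrm (f + g) \<le> nrm f + nrm g"
  shows "Metric_space S (norm_dist S nrm)"
proof
  fix f g
  show "0 \<le> norm_dist S nrm f g"
    by (simp add: norm_dist_def nonneg S cfun.subspace_diff)
  show "norm_dist S nrm f g = norm_dist S nrm g f"
    using minus[of "f - g"] by (auto simp: norm_dist_def S cfun.subspace_diff)
next
  fix f g assume "f \<in> S" "g \<in> S"
  then show "norm_dist S nrm f g = 0 \<longleftrightarrow> f = g"
    by (simp add: norm_dist_def zero S cfun.subspace_diff)
next
  fix f g h assume *: "f \<in> S" "g \<in> S" "h \<in> S"
  then have "nrm ((f - g) + (g - h)) \<le> nrm (f - g) + nrm (g - h)"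
    by (intro add cfun.subspace_diff S)
  then show "norm_dist S nrm f h \<le> norm_dist S nrm f g + norm_dist S nrm g h"
    using * by (simp add: norm_dist_def)
qed


subsection \<open>Reproducing kernel Hilbert spaces\<close>

definition ip_norm ::
    "(('a \<Rightarrow> complex) \<Rightarrow> ('a \<Rightarrow> complex) \<Rightarrow> complex) \<Rightarrow> ('a \<Rightarrow> complex) \<Rightarrow> real" where
  "ip_norm ip f = sqrt (Re (ip f f))"

locale inner_product_function_space =
  fixes H :: "('a \<Rightarrow> complex) set"
    and ip :: "('a \<Rightarrow> complex) \<Rightarrow> ('a \<Rightarrow> complex) \<Rightarrow> complex"
  assumes subspace: "cfun.subspace H"
    and ip_add: "\<lbrakk>f \<in> H; g \<in> H; h \<in> H\<rbrakk> \<Longrightarrow> ip (f + g) h = ip f h + ip g h"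
    and ip_scale: "\<lbrakk>f \<in> H; g \<in> H\<rbrakk> \<Longrightarrow> ip (fun_scale c f) g = c * ip f g"
    and ip_cnj: "\<lbrakk>f \<in> H; g \<in> H\<rbrakk> \<Longrightarrow> ip g f = cnj (ip f g)"
    and ip_nonneg: "f \<in> H \<Longrightarrow> 0 \<le> Re (ip f f)"
    and ip_definite: "\<lbrakk>f \<in> H; ip f f = 0\<rbrakk> \<Longrightarrow> f = 0"

locale rkhs = inner_product_function_space H ip
  for H :: "('a \<Rightarrow> complex) set"
    and ip :: "('a \<Rightarrow> complex) \<Rightarrow> ('a \<Rightarrow> complex) \<Rightarrow> complex" +
  assumes complete: "Metric_space.mcomplete H (norm_dist H (ip_norm ip))"
    and separable: "separable_space (norm_topology H (ip_norm ip))"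
    and evaluation_bounded: "\<exists>C. \<forall>f\<in>H. cmod (f x) \<le> C * ip_norm ip f"

definition reproducing_kernel ::
    "('a \<Rightarrow> complex) set \<Rightarrow> (('a \<Rightarrow> complex) \<Rightarrow> ('a \<Rightarrow> complex) \<Rightarrow> complex)
      \<Rightarrow> ('a \<Rightarrow> 'a \<Rightarrow> complex) \<Rightarrow> bool" where
  "reproducing_kernel H ip K \<longleftrightarrow>
     (\<forall>w. (\<lambda>z. K z w) \<in> H \<and> (\<forall>f\<in>H. f w = ip f (\<lambda>z. K z w)))"

text \<open>
  Square summable sequences; the open unit ball of \<open>\<complex>\<^sup>d\<close> for finite \<open>d\<close> is contained in \<open>ell2_ball\<close>
  through extension by zero, compatibly with the inner product, so a map into the latter covers all
  \<open>d\<close> in \<open>\<nat> \<union> {\<infinity>}\<close>.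
\<close>

definition ell2_ball :: "(nat \<Rightarrow> complex) set" where
  "ell2_ball = {a. summable (\<lambda>i. (cmod (a i))\<^sup>2) \<and> (\<Sum>i. (cmod (a i))\<^sup>2) < 1}"

definition ell2_inner :: "(nat \<Rightarrow> complex) \<Rightarrow> (nat \<Rightarrow> complex) \<Rightarrow> complex" where
  "ell2_inner a b = (\<Sum>i. a i * cnj (b i))"

locale normalized_complete_pick_space = rkhs H ip
  for H :: "('a \<Rightarrow> complex) set"
    and ip :: "('a \<Rightarrow> complex) \<Rightarrow> ('a \<Rightarrow> complex) \<Rightarrow> complex" +
  fixes K :: "'a \<Rightarrow> 'a \<Rightarrow> complex"
  assumes kernel: "reproducing_kernel H ip K"
    and normalized_pick:
      "\<exists>z0. (\<forall>z. K z z0 = 1) \<and>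
         (\<exists>b :: 'a \<Rightarrow> nat \<Rightarrow> complex. range b \<subseteq> ell2_ball \<and> b z0 = (\<lambda>_. 0) \<and>
            (\<forall>z w. K z w = 1 / (1 - ell2_inner (b z) (b w))))"


subsection \<open>Weak products\<close>

definition weak_product_rep ::
    "('a \<Rightarrow> complex) set \<Rightarrow> (('a \<Rightarrow> complex) \<Rightarrow> real) \<Rightarrow> ('a \<Rightarrow> complex)
      \<Rightarrow> (nat \<Rightarrow> 'a \<Rightarrow> complex) \<Rightarrow> (nat \<Rightarrow> 'a \<Rightarrow> complex) \<Rightarrow> bool" where
  "weak_product_rep H nrm h f g \<longleftrightarrow>
     (\<forall>n. f n \<in> H \<and> g n \<in> H) \<and>
     summable (\<lambda>n. nrm (f n) * nrm (g n)) \<and>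
     (\<forall>x. (\<lambda>n. f n x * g n x) sums h x)"

definition weak_product ::
    "('a \<Rightarrow> complex) set \<Rightarrow> (('a \<Rightarrow> complex) \<Rightarrow> real) \<Rightarrow> ('a \<Rightarrow> complex) set" where
  "weak_product H nrm = {h. \<exists>f g. weak_product_rep H nrm h f g}"

definition weak_product_norm ::
    "('a \<Rightarrow> complex) set \<Rightarrow> (('a \<Rightarrow> complex) \<Rightarrow> real) \<Rightarrow> ('a \<Rightarrow> complex) \<Rightarrow> real" where
  "weak_product_norm H nrm h =
     Inf {(\<Sum>n. nrm (f n) * nrm (g n)) | f g. weak_product_rep H nrm h f g}"


subsection \<open>Closed multiplier invariant subspaces\<close>

definition multipliers :: "('a \<Rightarrow> complex) set \<Rightarrow> ('a \<Rightarrow> complex) set" where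
  "multipliers B = {\<phi>. \<forall>f\<in>B. \<phi> * f \<in> B}"

definition closed_mult_invariant_subspaces ::
    "('a \<Rightarrow> complex) set \<Rightarrow> (('a \<Rightarrow> complex) \<Rightarrow> real) \<Rightarrow> ('a \<Rightarrow> complex) set set" where
  "closed_mult_invariant_subspaces B nrm =
     {M. cfun.subspace M \<and> closedin (norm_topology B nrm) M \<and>
         (\<forall>\<phi>\<in>multipliers B. \<forall>f\<in>M. \<phi> * f \<in> M)}"


subsection \<open>The two norms induce metrics\<close>

context inner_product_function_space
begin

abbreviation "nrm \<equiv> ip_norm ip"

lemma ip_add_right:
  assumes "f \<in> H" "g \<in> H" "h \<in> H"
  shows "ip h (f + g) = ip h f + ip h g"
  using ip_cnj[OF cfun.subspace_add[OF subspace assms(1,2)] assms(3)]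
    ip_cnj[OF assms(1,3)] ip_cnj[OF assms(2,3)] ip_add[OF assms] by simp

lemma ip_scale_right:
  assumes "f \<in> H" "g \<in> H"
  shows "ip g (fun_scale c f) = cnj c * ip g f"
  using ip_cnj[OF cfun.subspace_scale[OF subspace assms(1)] assms(2), of c]
    ip_cnj[OF assms] ip_scale[OF assms] by simp

lemma nrm_nonneg: "f \<in> H \<Longrightarrow> 0 \<le> nrm f"
  by (simp add: ip_norm_def ip_nonneg)

lemma ip_self:
  assumes "f \<in> H"
  shows "ip f f = of_real ((nrm f)\<^sup>2)"
proof -
  have "Im (ip f f) = - Im (ip f f)"
    using arg_cong[OF ip_cnj[OF assms assms], of Im] by (simp only: cnj.sel)
  then show ?thesis
    by (intro complex_eqI) (simp_all add: ip_norm_def ip_nonneg assms)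
qed

lemma nrm_zero_iff:
  assumes f: "f \<in> H"
  shows "nrm f = 0 \<longleftrightarrow> f = 0"
proof
  assume "nrm f = 0"
  then have "ip f f = 0" unfolding ip_self[OF f] by simp
  then show "f = 0" by (rule ip_definite[OF f])
next
  assume "f = 0"
  then have "fun_scale 0 f = f" by simp
  then have "ip f f = 0" using ip_scale[OF f f, of 0] by simp
  then show "nrm f = 0" by (simp add: ip_norm_def)
qed

lemma nrm_scale: "f \<in> H \<Longrightarrow> nrm (fun_scale c f) = cmod c * nrm f"
proof -
  assume f: "f \<in> H"
  then have "ip (fun_scale c f) (fun_scale c f) = c * cnj c * ip f f"
    by (simp add: ip_scale ip_scale_right subspace cfun.subspace_scale)
  then have "Re (ip (fun_scale c f) (fun_scale c f)) = (cmod c)\<^sup>2 * (nrm f)\<^sup>2"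
    by (metis Re_complex_of_real complex_norm_square f ip_self of_real_mult)
  then show ?thesis
    by (simp add: ip_norm_def[of ip "fun_scale c f"] real_sqrt_mult nrm_nonneg f)
qed

lemma Cauchy_Schwarz:
  assumes f: "f \<in> H" and g: "g \<in> H"
  shows "cmod (ip f g) \<le> nrm f * nrm g"
proof (cases "g = 0")
  case True
  then show ?thesis
    using ip_scale_right[OF g f, of 0] mult_nonneg_nonneg[OF nrm_nonneg[OF f] nrm_nonneg[OF g]] by simp
next
  case False
  then have pos: "0 < nrm g" using nrm_zero_iff[OF g] nrm_nonneg[OF g] by simp
  define p q c where "p = ip f g" and "q = (of_real ((nrm g)\<^sup>2) :: complex)" and "c = - (p / q)"
  have q: "q \<noteq> 0" "cnj q = q" using pos by (auto simp: q_def)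
  have cg: "fun_scale c g \<in> H" by (rule cfun.subspace_scale[OF subspace g])
  have fcg: "f + fun_scale c g \<in> H" by (rule cfun.subspace_add[OF subspace f cg])
  have "ip (f + fun_scale c g) (f + fun_scale c g)
      = (ip f f + c * ip g f) + (cnj c * ip f g + c * (cnj c * ip g g))"
    by (simp only: ip_add_right[OF f cg fcg] ip_add[OF f cg f] ip_add[OF f cg cg]
        ip_scale[OF g f] ip_scale[OF g cg] ip_scale_right[OF g f] ip_scale_right[OF g g])
  also have "\<dots> = ip f f + c * cnj p + (cnj c * p + c * (cnj c * q))"
    by (simp add: ip_cnj[OF f g] p_def q_def ip_self[OF g])
  also have "\<dots> = ip f f - p * cnj p / q"
    using q by (simp add: c_def field_simps)
  also have "\<dots> = of_real ((nrm f)\<^sup>2 - (cmod p)\<^sup>2 / (nrm g)\<^sup>2)"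
    by (simp add: ip_self[OF f] q_def complex_norm_square[symmetric])
  finally have "0 \<le> (nrm f)\<^sup>2 - (cmod (ip f g))\<^sup>2 / (nrm g)\<^sup>2"
    using ip_nonneg[OF fcg] by (simp only: Re_complex_of_real p_def)
  then have "(cmod (ip f g))\<^sup>2 \<le> (nrm f * nrm g)\<^sup>2"
    using pos by (simp add: field_simps power_mult_distrib)
  then show ?thesis
    by (rule power2_le_imp_le) (simp add: nrm_nonneg f g)
qed

lemma nrm_add:
  assumes f: "f \<in> H" and g: "g \<in> H"
  shows "nrm (f + g) \<le> nrm f + nrm g"
proof (rule power2_le_imp_le)
  have fg: "f + g \<in> H" by (rule cfun.subspace_add[OF subspace f g])
  have "ip (f + g) (f + g) = (ip f f + ip g f) + (ip f g + ip g g)"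
    by (simp only: ip_add_right[OF f g fg] ip_add[OF f g f] ip_add[OF f g g])
  then have "(nrm (f + g))\<^sup>2 = (nrm f)\<^sup>2 + 2 * Re (ip f g) + (nrm g)\<^sup>2"
    using ip_cnj[OF f g] ip_nonneg[OF f] ip_nonneg[OF g] ip_nonneg[OF fg]
    by (simp add: ip_norm_def del: plus_complex.sel) simp
  moreover have "Re (ip f g) \<le> nrm f * nrm g"
    using Cauchy_Schwarz[OF f g] complex_Re_le_cmod order_trans by blast
  ultimately show "(nrm (f + g))\<^sup>2 \<le> (nrm f + nrm g)\<^sup>2"
    by (simp add: power2_sum)
qed (simp add: nrm_nonneg f g)

lemma fun_uminus_eq_scale: "- f = fun_scale (-1) (f :: 'a \<Rightarrow> complex)"
  by (simp add: fun_scale_def fun_eq_iff)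

lemma Metric_space_ip_norm: "Metric_space H (norm_dist H nrm)"
proof (rule Metric_space_norm_dist)
  fix f assume "f \<in> H"
  then show "nrm (- f) = nrm f"
    using nrm_scale[of f "-1"] unfolding fun_uminus_eq_scale by simp
qed (fact subspace | rule nrm_nonneg nrm_zero_iff nrm_add; assumption)+

abbreviation "W \<equiv> weak_product H nrm"
abbreviation "Wnrm \<equiv> weak_product_norm H nrm"

lemma rep_sum_nonneg: "weak_product_rep H nrm h f g \<Longrightarrow> 0 \<le> (\<Sum>n. nrm (f n) * nrm (g n))"
  by (rule suminf_nonneg) (auto simp: weak_product_rep_def nrm_nonneg)

lemma Wnrm_le: "weak_product_rep H nrm h f g \<Longrightarrow> Wnrm h \<le> (\<Sum>n. nrm (f n) * nrm (g n))"
  unfolding weak_product_norm_def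
  by (rule cInf_lower) (auto intro!: bdd_belowI[of _ 0] rep_sum_nonneg)

lemma Wnrm_greatest:
  assumes "h \<in> W" "\<And>f g. weak_product_rep H nrm h f g \<Longrightarrow> c \<le> (\<Sum>n. nrm (f n) * nrm (g n))"
  shows "c \<le> Wnrm h"
  unfolding weak_product_norm_def
  by (rule cInf_greatest) (use assms in \<open>auto simp: weak_product_def\<close>)

lemma Wnrm_nonneg: "h \<in> W \<Longrightarrow> 0 \<le> Wnrm h"
  by (rule Wnrm_greatest) (auto intro: rep_sum_nonneg)

lemma rep_add:
  assumes "weak_product_rep H nrm h f g" "weak_product_rep H nrm h' f' g'"
  obtains F G where "weak_product_rep H nrm (h + h') F G"
    "(\<Sum>n. nrm (F n) * nrm (G n)) = (\<Sum>n. nrm (f n) * nrm (g n)) + (\<Sum>n. nrm (f' n) * nrm (g' n))"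
proof -
  define mix :: "(nat \<Rightarrow> 'a \<Rightarrow> complex) \<Rightarrow> _ \<Rightarrow> _" where
    "mix u v = (\<lambda>n. if even n then u (n div 2) else v ((n - 1) div 2))" for u v
  have sums: "(\<lambda>n. if even n then u (n div 2) else v ((n - 1) div 2)) sums (a + b)"
    if "u sums a" "v sums b" for u v :: "nat \<Rightarrow> 'b::real_normed_vector" and a b
  proof -
    have u: "(\<lambda>n. if even n then u (n div 2) else 0) sums a"
      by (subst sums_mono_reindex[of "\<lambda>n. 2 * n", symmetric])
        (use that(1) in \<open>auto simp: strict_mono_def elim!: evenE\<close>)
    have v: "(\<lambda>n. if odd n then v ((n - 1) div 2) else 0) sums b"
      by (subst sums_mono_reindex[of "\<lambda>n. 2 * n + 1", symmetric])
        (use that(2) in \<open>auto simp: strict_mono_def image_iff elim!: oddE\<close>)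
    show ?thesis
      using sums_add[OF u v] by (rule back_subst[of "\<lambda>f. f sums _"]) auto
  qed
  have "(\<lambda>n. nrm (f n) * nrm (g n)) sums (\<Sum>n. nrm (f n) * nrm (g n))"
    "(\<lambda>n. nrm (f' n) * nrm (g' n)) sums (\<Sum>n. nrm (f' n) * nrm (g' n))"
    using assms by (auto simp: weak_product_rep_def summable_sums)
  from sums[OF this] have *: "(\<lambda>n. nrm (mix f f' n) * nrm (mix g g' n)) sums
    ((\<Sum>n. nrm (f n) * nrm (g n)) + (\<Sum>n. nrm (f' n) * nrm (g' n)))"
    by (rule back_subst[of "\<lambda>f. f sums _"]) (auto simp: mix_def)
  have "(\<lambda>n. mix f f' n x * mix g g' n x) sums (h x + h' x)" for x
  proof -
    have "(\<lambda>n. f n x * g n x) sums h x" "(\<lambda>n. f' n x * g' n x) sums h' x"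
      using assms by (auto simp: weak_product_rep_def)
    from sums[OF this] show ?thesis
      by (rule back_subst[of "\<lambda>f. f sums _"]) (auto simp: mix_def)
  qed
  moreover have "mix f f' n \<in> H \<and> mix g g' n \<in> H" for n
    using assms by (simp add: weak_product_rep_def mix_def)
  ultimately have "weak_product_rep H nrm (h + h') (mix f f') (mix g g')"
    using sums_summable[OF *] by (simp add: weak_product_rep_def)
  then show ?thesis
    by (rule that) (rule sums_unique[OF *, symmetric])
qed

lemma rep_scale:
  assumes "weak_product_rep H nrm h f g"
  shows "weak_product_rep H nrm (fun_scale c h) (\<lambda>n. fun_scale c (f n)) g"
    and "(\<Sum>n. nrm (fun_scale c (f n)) * nrm (g n)) = cmod c * (\<Sum>n. nrm (f n) * nrm (g n))"
proof -
  have "f n \<in> H" for n using assms by (simp add: weak_product_rep_def)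
  then have eq: "nrm (fun_scale c (f n)) * nrm (g n) = cmod c * (nrm (f n) * nrm (g n))" for n
    by (simp add: nrm_scale)
  show "weak_product_rep H nrm (fun_scale c h) (\<lambda>n. fun_scale c (f n)) g"
    using assms cfun.subspace_scale[OF subspace] unfolding weak_product_rep_def eq
    by (auto simp: summable_mult) (simp add: fun_scale_def mult.assoc sums_mult)
  show "(\<Sum>n. nrm (fun_scale c (f n)) * nrm (g n)) = cmod c * (\<Sum>n. nrm (f n) * nrm (g n))"
    unfolding eq using assms by (simp add: weak_product_rep_def suminf_mult)
qed

lemma W_subspace: "cfun.subspace W"
proof (rule cfun.subspaceI)
  have "weak_product_rep H nrm 0 (\<lambda>_. 0) (\<lambda>_. 0)"
    using cfun.subspace_0[OF subspace] nrm_zero_iff[of 0] by (simp add: weak_product_rep_def)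
  then show "0 \<in> W" by (auto simp: weak_product_def)
next
  fix h h' assume "h \<in> W" "h' \<in> W"
  then obtain f g f' g' where
    "weak_product_rep H nrm h f g" "weak_product_rep H nrm h' f' g'"
    unfolding weak_product_def by blast
  then obtain F G where "weak_product_rep H nrm (h + h') F G" by (rule rep_add)
  then show "h + h' \<in> W" unfolding weak_product_def by blast
next
  fix c h assume "h \<in> W"
  then obtain f g where "weak_product_rep H nrm h f g"
    unfolding weak_product_def by blast
  from rep_scale(1)[OF this] show "fun_scale c h \<in> W"
    unfolding weak_product_def by blast
qed

lemma Wnrm_add: "h \<in> W \<Longrightarrow> h' \<in> W \<Longrightarrow> Wnrm (h + h') \<le> Wnrm h + Wnrm h'"
proof -
  assume h: "h \<in> W" and h': "h' \<in> W"
  have "Wnrm (h + h') \<le> (\<Sum>n. nrm (f n) * nrm (g n)) + (\<Sum>n. nrm (f' n) * nrm (g' n))"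
    if "weak_product_rep H nrm h f g" "weak_product_rep H nrm h' f' g'" for f g f' g'
    by (rule rep_add[OF that]) (metis Wnrm_le)
  then have "Wnrm (h + h') - (\<Sum>n. nrm (f n) * nrm (g n)) \<le> Wnrm h'"
    if "weak_product_rep H nrm h f g" for f g
    using that by (intro Wnrm_greatest[OF h']) (fastforce simp: algebra_simps)
  then have "Wnrm (h + h') - Wnrm h' \<le> Wnrm h"
    by (intro Wnrm_greatest[OF h]) (fastforce simp: algebra_simps)
  then show ?thesis by simp
qed

lemma Wnrm_minus:
  assumes h: "h \<in> W"
  shows "Wnrm (- h) = Wnrm h"
proof (rule antisym)
  have le: "Wnrm (- u) \<le> Wnrm u" if "u \<in> W" for u
  proof (rule Wnrm_greatest[OF that])
    fix f g assume rep: "weak_product_rep H nrm u f g"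
    have "Wnrm (fun_scale (-1) u) \<le> (\<Sum>n. nrm (fun_scale (-1) (f n)) * nrm (g n))"
      by (rule Wnrm_le[OF rep_scale(1)[OF rep]])
    also have "\<dots> = (\<Sum>n. nrm (f n) * nrm (g n))"
      unfolding rep_scale(2)[OF rep] by simp
    finally show "Wnrm (- u) \<le> (\<Sum>n. nrm (f n) * nrm (g n))"
      unfolding fun_uminus_eq_scale .
  qed
  show "Wnrm (- h) \<le> Wnrm h" by (rule le[OF h])
  have "Wnrm (- (- h)) \<le> Wnrm (- h)" by (rule le[OF cfun.subspace_neg[OF W_subspace h]])
  then show "Wnrm h \<le> Wnrm (- h)" unfolding minus_minus .
qed

end

context rkhs
begin

lemma Wnrm_zero_iff:
  assumes h: "h \<in> W"
  shows "Wnrm h = 0 \<longleftrightarrow> h = 0"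
proof
  assume 0: "Wnrm h = 0"
  show "h = 0"
  proof
    fix x
    obtain C where C: "\<And>f. f \<in> H \<Longrightarrow> cmod (f x) \<le> C * nrm f"
      using evaluation_bounded by blast
    define D where "D = \<bar>C\<bar> + 1"
    have D: "cmod (f x) \<le> D * nrm f" if "f \<in> H" for f
    proof -
      have "C * nrm f \<le> D * nrm f"
        by (rule mult_right_mono) (auto simp: D_def nrm_nonneg that)
      then show ?thesis using C[OF that] by linarith
    qed
    have D_pos: "0 < D" by (simp add: D_def)
    have "cmod (h x) / D\<^sup>2 \<le> (\<Sum>n. nrm (f n) * nrm (g n))"
      if rep: "weak_product_rep H nrm h f g" for f g
    proof -
      have fg: "f n \<in> H" "g n \<in> H" for n using rep by (auto simp: weak_product_rep_def)
      have le: "norm (f n x * g n x) \<le> D\<^sup>2 * (nrm (f n) * nrm (g n))" for n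
        using mult_mono[OF D[OF fg(1)] D[OF fg(2)], of n n] D_pos nrm_nonneg[OF fg(1)]
        by (simp add: norm_mult power2_eq_square mult_ac)
      have sum: "summable (\<lambda>n. D\<^sup>2 * (nrm (f n) * nrm (g n)))"
        using rep by (simp add: weak_product_rep_def summable_mult)
      have "cmod (\<Sum>n. f n x * g n x) \<le> (\<Sum>n. D\<^sup>2 * (nrm (f n) * nrm (g n)))"
        using le sum by (intro norm_suminf_le) auto
      moreover have "(\<Sum>n. f n x * g n x) = h x"
        using rep by (auto simp: weak_product_rep_def sums_iff)
      moreover have "(\<Sum>n. D\<^sup>2 * (nrm (f n) * nrm (g n))) = D\<^sup>2 * (\<Sum>n. nrm (f n) * nrm (g n))"
        using rep by (simp add: weak_product_rep_def suminf_mult)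
      ultimately show ?thesis using D_pos by (simp add: field_simps)
    qed
    then have "cmod (h x) / D\<^sup>2 \<le> 0"
      using Wnrm_greatest[OF h] 0 by metis
    then show "h x = 0 x" using D_pos by (simp add: divide_le_0_iff)
  qed
next
  assume "h = 0"
  have "weak_product_rep H nrm 0 (\<lambda>_. 0) (\<lambda>_. 0)"
    using cfun.subspace_0[OF subspace] nrm_zero_iff[of 0] by (simp add: weak_product_rep_def)
  from Wnrm_le[OF this] have "Wnrm h \<le> 0"
    using nrm_zero_iff[of 0] cfun.subspace_0[OF subspace] \<open>h = 0\<close> by simp
  then show "Wnrm h = 0" using Wnrm_nonneg[OF h] by simp
qed

lemma Metric_space_weak_product_norm: "Metric_space W (norm_dist W Wnrm)"
  by (rule Metric_space_norm_dist)
    (simp_all add: W_subspace Wnrm_nonneg Wnrm_zero_iff Wnrm_minus Wnrm_add)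

end

end

theory Submission
  imports Defs
begin

text \<open>
  A function \<open>V\<close> for which the kernel \<open>K z w * (V z + cnj (V w))\<close> is positive yields contractive
  multipliers \<open>1 / (1 + t V)\<close>. For \<open>f\<close> in \<open>H\<close>, the Herglotz function \<open>V z = 2 \<langle>f, k\<^sub>z f\<rangle> - \<parallel>f\<parallel>\<^sup>2\<close> is
  not only of this kind, it satisfies \<open>M\<^sub>f M\<^sub>f\<^sup>* \<le> Re V\<close>. In the Fock space model this says that
  \<open>\<parallel>M\<^sub>f\<^sup>* h\<parallel>\<^sup>2 \<le> \<parallel>f \<otimes> h\<parallel>\<^sup>2\<close> for symmetric tensors, by the Cauchy-Schwarz inequality for \<open>f \<otimes> h\<close> and
  \<open>h \<otimes> f\<close>; a linear bound in \<open>f \<otimes> f\<^sup>*\<close> can be summed, so \<open>1 / (1 + t V)\<close> with \<open>V\<close> the sum of the Herglotz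
  functions of a square summable sequence turns it into a bounded row of multipliers. Hence for
  \<open>h = \<Sum>\<^sub>n f\<^sub>n g\<^sub>n\<close> in the weak product, \<open>h / (1 + t V)\<close> lies in \<open>H\<close>, with norm controlled by the weak
  product norm of \<open>h\<close>, and tends to \<open>h\<close> as \<open>t\<close> tends to 0. The column-row property of complete Pick
  spaces is not needed.
\<close>


section \<open>Positive kernels\<close>

text \<open>The norm of the weak product is weaker than that of \<open>H\<close>. So the hard
  inclusion is that an element \<open>f\<close> of \<open>H\<close>, approximated in the weak
  product by elements \<open>m\<close> of \<open>M\<close>, lies in \<open>M\<close>. There
  \<open>t\<close> stays equal to 1 and the regularizer \<xi> is built from a factorization of
  \<open>f - m\<close> itself: small square sums make \<xi> close to 1 and also make
  \<open>\<xi> * (f - m)\<close> small in \<open>H\<close>, so \<open>\<xi> * m\<close> is close to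
  \<open>f\<close>. Elsewhere the regularized function is fixed and \<open>t\<close> tends to 0. The
  second obstacle is that multipliers of \<open>H\<close> and of the weak product are a priori
  different and come without bounds. A multiplier of either space is its own product with 1, hence
  an element of that space; regularizing it once or twice gives a multiplier with a bound, and such
  a multiplier acts on both spaces. The Fock space inequality is proved through kernels: the defect
  in the Cauchy-Schwarz inequality for tensors shows up as the Gram kernel of wedge products of
  points of the ball.\<close>

definition psd :: "nat \<Rightarrow> (nat \<Rightarrow> nat \<Rightarrow> complex) \<Rightarrow> bool" where
  "psd n A \<longleftrightarrow> (\<forall>c. 0 \<le> Re (\<Sum>i<n. \<Sum>j<n. c i * cnj (c j) * A i j))"

definition pos_kernel :: "('i \<Rightarrow> 'i \<Rightarrow> complex) \<Rightarrow> bool" where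
  "pos_kernel \<kappa> \<longleftrightarrow> (\<forall>n x. psd n (\<lambda>i j. \<kappa> (x i) (x j)))"

text \<open>
  Since \<open>psd\<close> only constrains the real part of the form, matrices need not be Hermitian. By Schur's
  product theorem Hermitian positive kernels have the following property. Taking it as the
  definition gives closure under products without Gram decompositions; testing on families indexed
  by \<open>nat\<close> makes it transferable between index types.
\<close>

definition schur_pos :: "('i \<Rightarrow> 'i \<Rightarrow> complex) \<Rightarrow> bool" where
  "schur_pos \<kappa> \<longleftrightarrow> (\<forall>n x B. psd n B \<longrightarrow> psd n (\<lambda>i j. \<kappa> (x i) (x j) * B i j))"

lemma psdD: "psd n A \<Longrightarrow> 0 \<le> Re (\<Sum>i<n. \<Sum>j<n. c i * cnj (c j) * A i j)"
  by (simp add: psd_def)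

lemma pos_kernelD: "pos_kernel \<kappa> \<Longrightarrow> psd n (\<lambda>i j. \<kappa> (x i) (x j))"
  by (simp add: pos_kernel_def)

lemma psd_add: "psd n A \<Longrightarrow> psd n B \<Longrightarrow> psd n (\<lambda>i j. A i j + B i j)"
  by (simp add: psd_def distrib_left sum.distrib del: times_complex.sel)

lemma psd_scale:
  assumes "psd n A" "0 \<le> r"
  shows "psd n (\<lambda>i j. of_real r * A i j)"
  unfolding psd_def
proof
  fix c
  have "(\<Sum>i<n. \<Sum>j<n. c i * cnj (c j) * (of_real r * A i j))
      = of_real r * (\<Sum>i<n. \<Sum>j<n. c i * cnj (c j) * A i j)"
    by (simp add: sum_distrib_left mult_ac)
  then show "0 \<le> Re (\<Sum>i<n. \<Sum>j<n. c i * cnj (c j) * (of_real r * A i j))"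
    using assms by (simp only: psd_def Re_complex_of_real Im_complex_of_real times_complex.sel) simp
qed

lemma psd_rank_one:
  assumes "psd n B"
  shows "psd n (\<lambda>i j. a i * cnj (a j) * B i j)"
  unfolding psd_def
proof
  fix c
  have "0 \<le> Re (\<Sum>i<n. \<Sum>j<n. (c i * a i) * cnj (c j * a j) * B i j)"
    by (rule psdD[OF assms])
  then show "0 \<le> Re (\<Sum>i<n. \<Sum>j<n. c i * cnj (c j) * (a i * cnj (a j) * B i j))"
    by (simp only: complex_cnj_mult mult_ac)
qed

lemma psd_1: "psd n (\<lambda>i j. 1)"
  unfolding psd_def
proof
  fix c :: "nat \<Rightarrow> complex"
  have "(\<Sum>i<n. \<Sum>j<n. c i * cnj (c j) * 1) = (\<Sum>i<n. c i) * cnj (\<Sum>i<n. c i)"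
    by (simp add: sum_product cnj_sum)
  also have "\<dots> = of_real ((cmod (\<Sum>i<n. c i))\<^sup>2)"
    by (rule complex_norm_square[symmetric])
  finally show "0 \<le> Re (\<Sum>i<n. \<Sum>j<n. c i * cnj (c j) * 1)"
    by (simp only: Re_complex_of_real) simp
qed

lemma psd_limit:
  assumes lim: "\<And>i j. (\<lambda>N. A N i j) \<longlonglongrightarrow> B i j" and psd: "\<And>N::nat. psd n (A N)"
  shows "psd n B"
  unfolding psd_def
proof
  fix c
  have "(\<lambda>N. Re (\<Sum>i<n. \<Sum>j<n. c i * cnj (c j) * A N i j))
      \<longlonglongrightarrow> Re (\<Sum>i<n. \<Sum>j<n. c i * cnj (c j) * B i j)"
    by (intro tendsto_Re tendsto_sum tendsto_mult tendsto_const lim)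
  then show "0 \<le> Re (\<Sum>i<n. \<Sum>j<n. c i * cnj (c j) * B i j)"
    by (rule LIMSEQ_le_const) (use psd in \<open>auto simp: psd_def\<close>)
qed

section \<open>Closure properties of the two kinds of positivity\<close>

lemma schur_posD: "schur_pos \<kappa> \<Longrightarrow> psd n B \<Longrightarrow> psd n (\<lambda>i j. \<kappa> (x i) (x j) * B i j)"
  by (simp add: schur_pos_def)

lemma schur_pos_imp_pos: "schur_pos \<kappa> \<Longrightarrow> pos_kernel \<kappa>"
  unfolding pos_kernel_def using schur_posD[OF _ psd_1] by fastforce

lemma pos_kernel_add:
  "pos_kernel \<kappa> \<Longrightarrow> pos_kernel \<rho> \<Longrightarrow> pos_kernel (\<lambda>z w. \<kappa> z w + \<rho> z w)"
  by (simp add: pos_kernel_def psd_add)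

lemma pos_kernel_scale: "pos_kernel \<kappa> \<Longrightarrow> 0 \<le> r \<Longrightarrow> pos_kernel (\<lambda>z w. of_real r * \<kappa> z w)"
  by (simp add: pos_kernel_def psd_scale)

lemma pos_kernel_rank_one: "pos_kernel \<kappa> \<Longrightarrow> pos_kernel (\<lambda>z w. a z * cnj (a w) * \<kappa> z w)"
  by (simp add: pos_kernel_def psd_rank_one)

lemma pos_kernel_limit:
  "(\<And>z w. (\<lambda>N. \<kappa> N z w) \<longlonglongrightarrow> \<rho> z w) \<Longrightarrow> (\<And>N::nat. pos_kernel (\<kappa> N)) \<Longrightarrow> pos_kernel \<rho>"
  unfolding pos_kernel_def by (intro allI) (rule psd_limit, assumption, blast)

lemma pos_kernel_0: "pos_kernel (\<lambda>z w. 0)"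
  by (simp add: pos_kernel_def psd_def)

lemma pos_kernel_sum:
  "finite I \<Longrightarrow> (\<And>i. i \<in> I \<Longrightarrow> pos_kernel (\<kappa> i)) \<Longrightarrow> pos_kernel (\<lambda>z w. \<Sum>i\<in>I. \<kappa> i z w)"
  by (induction I rule: finite_induct) (simp_all add: pos_kernel_0 pos_kernel_add)

lemma pos_kernel_finite:
  assumes \<kappa>: "pos_kernel \<kappa>" and "finite I"
  shows "0 \<le> Re (\<Sum>\<alpha>\<in>I. \<Sum>\<beta>\<in>I. c \<alpha> * cnj (c \<beta>) * \<kappa> (g \<alpha>) (g \<beta>))"
proof -
  obtain h where h: "bij_betw h {..<card I} I"
    using ex_bij_betw_nat_finite[OF \<open>finite I\<close>] by (auto simp: atLeast0LessThan)
  have "0 \<le> Re (\<Sum>i<card I. \<Sum>j<card I. c (h i) * cnj (c (h j)) * \<kappa> (g (h i)) (g (h j)))"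
    by (rule psdD[OF pos_kernelD[OF \<kappa>]])
  then show ?thesis
    by (simp only: sum.reindex_bij_betw[OF h, symmetric])
qed

lemma pos_kernel_sums:
  assumes "\<And>z w. (\<lambda>n. \<kappa> n z w) sums \<rho> z w" "\<And>n::nat. pos_kernel (\<kappa> n)"
  shows "pos_kernel \<rho>"
  by (rule pos_kernel_limit[of "\<lambda>N z w. \<Sum>n<N. \<kappa> n z w"])
    (use assms in \<open>auto simp: sums_def intro: pos_kernel_sum\<close>)

lemma pos_kernel_diagonal:
  assumes "pos_kernel \<kappa>"
  shows "0 \<le> Re (\<kappa> z z)"
proof -
  have "psd 1 (\<lambda>i j. \<kappa> z z)" using pos_kernelD[OF assms, of 1 "\<lambda>_. z"] .
  from psdD[OF this, of "\<lambda>_. 1"] show ?thesis by simp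
qed

lemma schur_pos_add:
  "schur_pos \<kappa> \<Longrightarrow> schur_pos \<rho> \<Longrightarrow> schur_pos (\<lambda>z w. \<kappa> z w + \<rho> z w)"
  by (simp add: schur_pos_def psd_add distrib_right)

lemma schur_pos_mult:
  "schur_pos \<kappa> \<Longrightarrow> schur_pos \<rho> \<Longrightarrow> schur_pos (\<lambda>z w. \<kappa> z w * \<rho> z w)"
  by (simp add: schur_pos_def mult.assoc)

lemma schur_pos_scale: "schur_pos \<kappa> \<Longrightarrow> 0 \<le> r \<Longrightarrow> schur_pos (\<lambda>z w. of_real r * \<kappa> z w)"
  by (simp add: schur_pos_def psd_scale mult.assoc)

lemma schur_pos_rank_one: "schur_pos (\<lambda>z w. a z * cnj (a w))"
  by (simp add: schur_pos_def psd_rank_one)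

lemma schur_pos_1: "schur_pos (\<lambda>z w. 1)"
  by (simp add: schur_pos_def)

lemma schur_pos_0: "schur_pos (\<lambda>z w. 0)"
  using schur_pos_scale[OF schur_pos_1, of 0] by simp

lemma schur_pos_limit:
  assumes "\<And>z w. (\<lambda>N. \<kappa> N z w) \<longlonglongrightarrow> \<rho> z w" "\<And>N::nat. schur_pos (\<kappa> N)"
  shows "schur_pos \<rho>"
  unfolding schur_pos_def
proof (intro allI impI)
  fix n x B assume B: "psd n B"
  show "psd n (\<lambda>i j. \<rho> (x i) (x j) * B i j)"
    by (rule psd_limit[OF tendsto_mult[OF assms(1) tendsto_const] schur_posD[OF assms(2) B]])
qed

lemma schur_pos_sum:
  "finite I \<Longrightarrow> (\<And>i. i \<in> I \<Longrightarrow> schur_pos (\<kappa> i)) \<Longrightarrow> schur_pos (\<lambda>z w. \<Sum>i\<in>I. \<kappa> i z w)"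
  by (induction I rule: finite_induct) (simp_all add: schur_pos_0 schur_pos_add)

lemma schur_pos_sums:
  assumes "\<And>z w. (\<lambda>n. \<kappa> n z w) sums \<rho> z w" "\<And>n::nat. schur_pos (\<kappa> n)"
  shows "schur_pos \<rho>"
  by (rule schur_pos_limit[of "\<lambda>N z w. \<Sum>n<N. \<kappa> n z w"])
    (use assms in \<open>auto simp: sums_def intro: schur_pos_sum\<close>)

lemma schur_pos_power: "schur_pos \<kappa> \<Longrightarrow> schur_pos (\<lambda>z w. \<kappa> z w ^ n)"
  by (induction n) (simp_all add: schur_pos_1 schur_pos_mult)

lemma schur_pos_exp:
  assumes "schur_pos \<kappa>"
  shows "schur_pos (\<lambda>z w. exp (\<kappa> z w))"
proof (rule schur_pos_sums)
  show "(\<lambda>n. of_real (inverse (fact n)) * \<kappa> z w ^ n) sums exp (\<kappa> z w)" for z w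
    using exp_converges[of "\<kappa> z w"] by (simp add: scaleR_conv_of_real)
  show "schur_pos (\<lambda>z w. of_real (inverse (fact n)) * \<kappa> z w ^ n)" for n
    by (intro schur_pos_scale schur_pos_power assms) simp
qed

lemma schur_pos_pullback: "schur_pos \<kappa> \<Longrightarrow> schur_pos (\<lambda>\<alpha> \<beta>. \<kappa> (g \<alpha>) (g \<beta>))"
  unfolding schur_pos_def by (intro allI impI) (drule spec, drule spec, drule spec, erule mp)

lemma sum_lessThan_double: "(\<Sum>a<2*n. g a) = (\<Sum>k<n. g (2*k) + g (2*k+1 :: nat))"
  by (induction n) (simp_all add: add.assoc)

text \<open>A pair acts as the formal sum of its two points, so this is \<kappa> on a family of
  twice the length, summed over blocks of two. A single summand such as
  \<open>\<kappa> (fst \<alpha>) (snd \<beta>)\<close> need not be positive on pairs.\<close>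

lemma schur_pos_pairs:
  fixes \<kappa> :: "'i \<Rightarrow> 'i \<Rightarrow> complex"
  assumes \<kappa>: "schur_pos \<kappa>"
  shows "schur_pos (\<lambda>\<alpha> \<beta>. \<kappa> (fst \<alpha>) (fst \<beta>) + \<kappa> (fst \<alpha>) (snd \<beta>)
    + \<kappa> (snd \<alpha>) (fst \<beta>) + \<kappa> (snd \<alpha>) (snd \<beta>))"
  unfolding schur_pos_def
proof (intro allI impI)
  fix n and x :: "nat \<Rightarrow> 'i \<times> 'i" and B assume B: "psd n B"
  \<comment> \<open>The pair \<open>x k\<close> occupies the positions \<open>2*k\<close> and
    \<open>2*k+1\<close>. Repeating \<open>B\<close> on these blocks keeps it positive, since its
    form then sees only the sum of the two coefficients.\<close>
  define y where "y a = (if even a then fst (x (a div 2)) else snd (x (a div 2)))" for a :: nat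
  have "psd (2*n) (\<lambda>a b. B (a div 2) (b div 2))"
    unfolding psd_def
  proof
    fix c :: "nat \<Rightarrow> complex"
    have "0 \<le> Re (\<Sum>i<n. \<Sum>j<n. (c (2*i) + c (2*i+1)) * cnj (c (2*j) + c (2*j+1)) * B i j)"
      by (rule psdD[OF B])
    then show "0 \<le> Re (\<Sum>i<2*n. \<Sum>j<2*n. c i * cnj (c j) * B (i div 2) (j div 2))"
      by (simp add: sum_lessThan_double distrib_left distrib_right sum.distrib add_ac
          del: times_complex.sel plus_complex.sel)
  qed
  from schur_posD[OF \<kappa> this, of y]
  have *: "psd (2*n) (\<lambda>a b. \<kappa> (y a) (y b) * B (a div 2) (b div 2))" .
  show "psd n (\<lambda>i j. (\<kappa> (fst (x i)) (fst (x j)) + \<kappa> (fst (x i)) (snd (x j))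
    + \<kappa> (snd (x i)) (fst (x j)) + \<kappa> (snd (x i)) (snd (x j))) * B i j)"
    unfolding psd_def
  proof
    fix c :: "nat \<Rightarrow> complex"
    \<comment> \<open>Coefficients that are constant on each block collect the four
      summands.\<close>
    have "0 \<le> Re (\<Sum>a<2*n. \<Sum>b<2*n. c (a div 2) * cnj (c (b div 2)) * (\<kappa> (y a) (y b) * B (a div 2) (b div 2)))"
      by (rule psdD[OF *])
    then show "0 \<le> Re (\<Sum>i<n. \<Sum>j<n. c i * cnj (c j) *
        ((\<kappa> (fst (x i)) (fst (x j)) + \<kappa> (fst (x i)) (snd (x j))
        + \<kappa> (snd (x i)) (fst (x j)) + \<kappa> (snd (x i)) (snd (x j))) * B i j))"
      by (simp add: sum_lessThan_double distrib_left distrib_right sum.distrib add_ac y_def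
          del: times_complex.sel plus_complex.sel)
  qed
qed

section \<open>Inner products of square summable sequences\<close>

text \<open>Each term is at most the mean of the two squares; the mean of two numbers below 1 is
  below 1.\<close>

lemma ell2_ball_summable:
  assumes "a \<in> ell2_ball" "b \<in> ell2_ball"
  shows "summable (\<lambda>i. a i * cnj (b i))" and "cmod (ell2_inner a b) < 1"
proof -
  define u where "u i = ((cmod (a i))\<^sup>2 + (cmod (b i))\<^sup>2) / 2" for i
  have le: "norm (a i * cnj (b i)) \<le> u i" for i
    using sum_squares_bound[of "cmod (a i)" "cmod (b i)"] by (simp add: u_def norm_mult)
  have u: "u sums (((\<Sum>i. (cmod (a i))\<^sup>2) + (\<Sum>i. (cmod (b i))\<^sup>2)) / 2)"
    unfolding u_def using assms
    by (intro sums_divide sums_add summable_sums) (auto simp: ell2_ball_def)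
  show "summable (\<lambda>i. a i * cnj (b i))"
    by (rule summable_comparison_test[OF _ sums_summable[OF u]]) (use le in auto)
  have "cmod (ell2_inner a b) \<le> suminf u"
    unfolding ell2_inner_def using le u by (intro norm_suminf_le) (auto dest: sums_summable)
  also have "\<dots> < 1" using u assms by (simp add: sums_iff ell2_ball_def)
  finally show "cmod (ell2_inner a b) < 1" .
qed

section \<open>The kernel of a map into the ball\<close>

locale ball_embedding =
  fixes b :: "'a \<Rightarrow> nat \<Rightarrow> complex"
  assumes ball: "b z \<in> ell2_ball"
begin

definition s :: "'a \<Rightarrow> 'a \<Rightarrow> complex" where "s z w = ell2_inner (b z) (b w)"

definition k :: "'a \<Rightarrow> 'a \<Rightarrow> complex" where "k z w = 1 / (1 - s z w)"

lemma s_less_1: "cmod (s z w) < 1"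
  unfolding s_def by (rule ell2_ball_summable[OF ball ball])

lemma s_nonzero: "1 - s z w \<noteq> 0"
  using s_less_1[of z w] by auto

lemma s_sums: "(\<lambda>i. b z i * cnj (b w i)) sums s z w"
  unfolding s_def ell2_inner_def by (rule summable_sums[OF ell2_ball_summable(1)[OF ball ball]])

lemma schur_pos_s: "schur_pos s"
  by (rule schur_pos_sums[OF s_sums]) (rule schur_pos_rank_one)

text \<open>The logarithm of \<open>k\<close> is a power series in \<open>s\<close> with nonnegative
  coefficients. Passing through it, rather than through the geometric series, turns products of
  kernels into sums.\<close>

lemma schur_pos_Ln: "schur_pos (\<lambda>z w. - Ln (1 - s z w))"
proof (rule schur_pos_sums)
  \<comment> \<open>At \<open>n = 0\<close> the coefficient \<open>1 / real 0\<close> is 0, so the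
    series starts with \<open>s z w\<close>.\<close>
  show "(\<lambda>n. of_real (1 / real n) * s z w ^ n) sums (- Ln (1 - s z w))" for z w
    using sums_minus[OF Ln_series'[of "- s z w"]] s_less_1[of z w] by simp
  show "schur_pos (\<lambda>z w. of_real (1 / real n) * s z w ^ n)" for n
    by (intro schur_pos_scale schur_pos_power schur_pos_s) simp
qed

lemma exp_Ln_s: "exp (- Ln (1 - s z w)) = k z w"
  using exp_Ln[OF s_nonzero[of z w]] by (simp add: exp_minus k_def inverse_eq_divide)

lemma schur_pos_k: "schur_pos k"
  using schur_pos_exp[OF schur_pos_Ln] by (simp add: exp_Ln_s)

text \<open>The mixed factors \<open>k z q\<close> and \<open>k p w\<close> are in general not
  positive on pairs, so this is no Schur product of positive kernels. The sum of the four logarithms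
  is positive, and the exponential preserves that.\<close>

lemma schur_pos_prod_k:
  "schur_pos (\<lambda>(z, p) (w, q). k z w * k z q * k p w * k p q)"
  using schur_pos_exp[OF schur_pos_pairs[OF schur_pos_Ln]]
  by (simp only: case_prod_unfold exp_add exp_Ln_s)

text \<open>The determinant is the inner product of the wedges of \<open>b z\<close> with
  \<open>b p\<close> and of \<open>b w\<close> with \<open>b q\<close>. The factor
  \<open>1/2\<close> in the proof compensates for counting every pair of coordinates in both
  orders.\<close>

lemma schur_pos_antisymmetric:
  "schur_pos (\<lambda>(z, p) (w, q). s z w * s p q - s z q * s p w)"
proof (rule schur_pos_limit)
  let ?s = "\<lambda>N z w. \<Sum>i<N. b z i * cnj (b w i)"
  let ?a = "\<lambda>i j \<alpha>. b (fst \<alpha>) i * b (snd \<alpha>) j - b (snd \<alpha>) i * b (fst \<alpha>) j"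
  let ?\<kappa> = "\<lambda>N \<alpha> \<beta>. of_real (1/2) * (\<Sum>i<N. \<Sum>j<N. ?a i j \<alpha> * cnj (?a i j \<beta>))"
  show "schur_pos (?\<kappa> N)" for N :: nat
    by (intro schur_pos_scale schur_pos_sum schur_pos_rank_one) auto
  have eq: "?\<kappa> N (z, p) (w, q) = ?s N z w * ?s N p q - ?s N z q * ?s N p w" for N z p w q
  proof -
    let ?t = "\<lambda>z w i. b z i * cnj (b w i)"
    have "(\<Sum>i<N. \<Sum>j<N. ?a i j (z, p) * cnj (?a i j (w, q)))
       = (\<Sum>i<N. \<Sum>j<N. ?t z w i * ?t p q j) - (\<Sum>i<N. \<Sum>j<N. ?t z q i * ?t p w j)
         - (\<Sum>i<N. \<Sum>j<N. ?t p w i * ?t z q j) + (\<Sum>i<N. \<Sum>j<N. ?t p q i * ?t z w j)"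
      by (simp add: sum.distrib[symmetric] sum_subtractf[symmetric] algebra_simps)
    then show ?thesis by (simp add: sum_product[symmetric])
  qed
  show "(\<lambda>N. ?\<kappa> N \<alpha> \<beta>) \<longlonglongrightarrow> (case \<alpha> of (z, p) \<Rightarrow> \<lambda>(w, q). s z w * s p q - s z q * s p w) \<beta>" for \<alpha> \<beta>
  proof (cases \<alpha>; cases \<beta>)
    fix z p w q assume "\<alpha> = (z, p)" "\<beta> = (w, q)"
    then show ?thesis
      using s_sums unfolding sums_def by (simp only: eq split) (intro tendsto_intros)
  qed
qed

text \<open>For \<open>k = 1 / (1 - s)\<close> one has
  \<open>k z q + k p w - 1 = (1 - s z q * s p w) * k z q * k p w\<close>. Hence both terms contain
  all four kernels, and their difference leaves only the determinant.\<close>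

lemma schur_pos_twisted:
  "schur_pos (\<lambda>(z, p) (w, q). k z w * k p q * (k z q + k p w - 1) - k z q * k p w * (k z w + k p q - 1))"
proof -
  have "k z w * k p q * (k z q + k p w - 1) - k z q * k p w * (k z w + k p q - 1)
      = (s z w * s p q - s z q * s p w) * (k z w * k z q * k p w * k p q)" for z p w q
    using s_nonzero by (simp add: k_def divide_simps) (auto simp: algebra_simps)
  then show ?thesis
    using schur_pos_mult[OF schur_pos_antisymmetric schur_pos_prod_k] by (simp add: case_prod_unfold)
qed

lemma k_eq: "k z w = 1 + s z w * k z w"
  using s_nonzero[of z w] by (simp add: k_def field_simps)

lemma schur_pos_k_minus_1: "schur_pos (\<lambda>z w. k z w - 1)"
proof -
  have "k z w - 1 = s z w * k z w" for z w by (metis k_eq add_diff_cancel_left')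
  then show ?thesis using schur_pos_mult[OF schur_pos_s schur_pos_k] by simp
qed

text \<open>If \<open>s w z\<close>, as a function of \<open>w\<close>, is a multiplier of norm at
  most \<open>r < 1\<close>, then \<open>1 / (1 - s w z)\<close> is one of norm at most
  \<open>1 / (1 - r)\<close>. This is expressed by an explicit decomposition of kernels.\<close>

lemma k_multiplier_bound:
  obtains C where "0 \<le> C"
    "pos_kernel (\<lambda>w w'. of_real (C\<^sup>2) * k w w' - k w z * cnj (k w' z) * k w w')"
proof -
  define \<rho> where "\<rho> = (\<Sum>i. (cmod (b z i))\<^sup>2)"
  have \<rho>: "0 \<le> \<rho>" "\<rho> < 1"
    using ball[of z] unfolding \<rho>_def ell2_ball_def by (auto intro: suminf_nonneg)
  have szz: "s z z = of_real \<rho>"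
  proof -
    have "(\<lambda>i. complex_of_real ((cmod (b z i))\<^sup>2)) sums of_real \<rho>"
      unfolding \<rho>_def using ball[of z] by (intro sums_of_real summable_sums) (simp add: ell2_ball_def)
    then show ?thesis
      using sums_unique2[OF s_sums[of z z]] by (simp only: complex_norm_square)
  qed
  have cnj_s: "cnj (s w z) = s z w" for w
    using sums_cnj[THEN iffD2, OF s_sums[of w z]] sums_unique2[OF s_sums[of z w]]
    by (simp add: mult.commute)
  \<comment> \<open>The midpoint of \<rho> and 1 is taken for \<open>r\<^sup>2\<close>: it is below
    1, at least \<rho>, and positive even if \<open>b z\<close> vanishes, so that
    \<open>1 / r\<close> makes sense.\<close>
  define r where "r = sqrt ((1 + \<rho>) / 2)"
  have r2: "r\<^sup>2 = (1 + \<rho>) / 2" using \<rho> by (simp add: r_def)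
  have r: "0 < r" "r < 1" using \<rho> by (simp_all add: r_def)
  define C where "C = 1 / (1 - r)"
  \<comment> \<open>The Cauchy-Schwarz inequality against the fixed vector \<open>b z\<close>, in
    kernel form.\<close>
  have "schur_pos (\<lambda>w w'. s w w' * s z z - s w z * s z w')"
    using schur_pos_pullback[OF schur_pos_antisymmetric, of "\<lambda>w. (w, z)"] by simp
  from schur_pos_add[OF this schur_pos_scale[OF schur_pos_s, of "r\<^sup>2 - \<rho>"]]
  moreover have "0 \<le> r\<^sup>2 - \<rho>" using \<rho> r2 by simp
  moreover have "s w w' * of_real \<rho> - s w z * s z w' + of_real (r\<^sup>2 - \<rho>) * s w w'
      = of_real (r\<^sup>2) * s w w' - s w z * s z w'" for w w'
    by (simp add: algebra_simps)
  ultimately have "schur_pos (\<lambda>w w'. of_real (r\<^sup>2) * s w w' - s w z * s z w')"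
    by (simp only: szz simp_thms)
  from schur_pos_add[OF schur_pos_mult[OF this schur_pos_k] schur_pos_scale[OF schur_pos_1, of "r\<^sup>2"]]
  \<comment> \<open>As \<open>k = 1 + s * k\<close>, this kernel is
    \<open>(r\<^sup>2 - s w z * s z w') * k w w'\<close>: it says that \<open>s w z\<close> has
    multiplier norm at most \<open>r\<close>.\<close>
  have 1: "schur_pos (\<lambda>w w'. (of_real (r\<^sup>2) * s w w' - s w z * s z w') * k w w' + of_real (r\<^sup>2))"
    by simp
  have 2: "schur_pos (\<lambda>w w'. (of_real r - s w z) * cnj (of_real r - s w' z) * k w w')"
    by (intro schur_pos_mult schur_pos_rank_one schur_pos_k)
  \<comment> \<open>The weights come from \<open>(1 - a) * (1 - b) - (1 - r)\<^sup>2 = (1 / r) * (r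
    - a) * (r - b) + (1 / r - 1) * (r\<^sup>2 - a * b)\<close> with \<open>a = s w z\<close> and
    \<open>b = s z w'\<close>.\<close>
  have "schur_pos (\<lambda>w w'. of_real (1 / r) * ((of_real r - s w z) * cnj (of_real r - s w' z) * k w w')
     + of_real (1 / r - 1) * ((of_real (r\<^sup>2) * s w w' - s w z * s z w') * k w w' + of_real (r\<^sup>2)))"
    by (intro schur_pos_add schur_pos_scale 1 2) (use r in \<open>auto simp: field_simps\<close>)
  from schur_pos_scale[OF schur_pos_mult[OF schur_pos_rank_one[of "\<lambda>w. k w z"] this], of "C\<^sup>2"]
  have *: "schur_pos (\<lambda>w w'. of_real (C\<^sup>2) * (k w z * cnj (k w' z) *
    (of_real (1 / r) * ((of_real r - s w z) * cnj (of_real r - s w' z) * k w w')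
     + of_real (1 / r - 1) * ((of_real (r\<^sup>2) * s w w' - s w z * s z w') * k w w' + of_real (r\<^sup>2)))))"
    by simp
  have "of_real (C\<^sup>2) * (k w z * cnj (k w' z) *
    (of_real (1 / r) * ((of_real r - s w z) * cnj (of_real r - s w' z) * k w w')
     + of_real (1 / r - 1) * ((of_real (r\<^sup>2) * s w w' - s w z * s z w') * k w w' + of_real (r\<^sup>2))))
    = of_real (C\<^sup>2) * k w w' - k w z * cnj (k w' z) * k w w'" for w w'
  proof -
    define R where "R = complex_of_real r"
    have R: "R \<noteq> 0" "1 - R \<noteq> 0" using r by (auto simp: R_def)
    have kk: "k w w' - s w w' * k w w' = 1" using k_eq[of w w'] by (simp add: algebra_simps)
    have kz: "k w z * (1 - s w z) = 1" "cnj (k w' z) * (1 - s z w') = 1"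
      using s_nonzero by (simp_all add: k_def cnj_s)
    have "(1 / R) * ((R - s w z) * (R - s z w') * k w w')
       + (1 / R - 1) * ((R\<^sup>2 * s w w' - s w z * s z w') * k w w' + R\<^sup>2 * (k w w' - s w w' * k w w'))
       = ((1 - s w z) * (1 - s z w') - (1 - R)\<^sup>2) * k w w'"
      using R by (simp add: field_simps) algebra
    then have e: "(1 / R) * ((R - s w z) * (R - s z w') * k w w')
       + (1 / R - 1) * ((R\<^sup>2 * s w w' - s w z * s z w') * k w w' + R\<^sup>2)
       = ((1 - s w z) * (1 - s z w') - (1 - R)\<^sup>2) * k w w'"
      unfolding kk mult_1_right .
    have "k w z * cnj (k w' z) * ((1 / R) * ((R - s w z) * (R - s z w') * k w w')
       + (1 / R - 1) * ((R\<^sup>2 * s w w' - s w z * s z w') * k w w' + R\<^sup>2))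
       = ((k w z * (1 - s w z)) * (cnj (k w' z) * (1 - s z w')) - (1 - R)\<^sup>2 * (k w z * cnj (k w' z))) * k w w'"
      unfolding e by (simp add: algebra_simps)
    then have **: "k w z * cnj (k w' z) * ((1 / R) * ((R - s w z) * (R - s z w') * k w w')
       + (1 / R - 1) * ((R\<^sup>2 * s w w' - s w z * s z w') * k w w' + R\<^sup>2))
       = (1 - (1 - R)\<^sup>2 * (k w z * cnj (k w' z))) * k w w'"
      unfolding kz by simp
    have C: "of_real (C\<^sup>2) * (1 - R)\<^sup>2 = 1"
      using R(2) by (simp add: C_def R_def power_divide)
    have "of_real (C\<^sup>2) * (k w z * cnj (k w' z) * ((1 / R) * ((R - s w z) * (R - s z w') * k w w')
       + (1 / R - 1) * ((R\<^sup>2 * s w w' - s w z * s z w') * k w w' + R\<^sup>2)))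
       = of_real (C\<^sup>2) * k w w' - (of_real (C\<^sup>2) * (1 - R)\<^sup>2) * (k w z * cnj (k w' z)) * k w w'"
      unfolding ** by (simp add: algebra_simps)
    then show ?thesis
      unfolding C by (simp add: R_def cnj_s)
  qed
  with * have "schur_pos (\<lambda>w w'. of_real (C\<^sup>2) * k w w' - k w z * cnj (k w' z) * k w w')"
    by simp
  moreover have "0 \<le> C" using r by (simp add: C_def)
  ultimately show ?thesis using that schur_pos_imp_pos by blast
qed

end


section \<open>Reproducing kernel Hilbert spaces\<close>

context inner_product_function_space
begin

lemma diff_eq_scale: "f - g = f + fun_scale (-1) (g :: 'a \<Rightarrow> complex)"
  by (simp add: fun_scale_def fun_eq_iff)

lemma nrm_square: "f \<in> H \<Longrightarrow> (nrm f)\<^sup>2 = Re (ip f f)"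
  by (simp add: ip_norm_def ip_nonneg)

lemma ip_diff: "f \<in> H \<Longrightarrow> g \<in> H \<Longrightarrow> h \<in> H \<Longrightarrow> ip (f - g) h = ip f h - ip g h"
  using ip_add[of f "fun_scale (-1) g" h] ip_scale[of g h "-1"] cfun.subspace_scale[OF subspace, of g "-1"]
  unfolding diff_eq_scale by simp

lemma ip_diff_right: "f \<in> H \<Longrightarrow> g \<in> H \<Longrightarrow> h \<in> H \<Longrightarrow> ip h (f - g) = ip h f - ip h g"
  using ip_add_right[of f "fun_scale (-1) g" h] ip_scale_right[of g h "-1"]
    cfun.subspace_scale[OF subspace, of g "-1"]
  unfolding diff_eq_scale by simp

lemma nrm_square_add:
  assumes f: "f \<in> H" and g: "g \<in> H"
  shows "(nrm (f + g))\<^sup>2 = (nrm f)\<^sup>2 + 2 * Re (ip f g) + (nrm g)\<^sup>2"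
proof -
  have fg: "f + g \<in> H" by (rule cfun.subspace_add[OF subspace f g])
  have "ip (f + g) (f + g) = (ip f f + ip g f) + (ip f g + ip g g)"
    by (simp only: ip_add_right[OF f g fg] ip_add[OF f g f] ip_add[OF f g g])
  moreover have "Re (ip g f) = Re (ip f g)" using ip_cnj[OF f g] by simp
  ultimately show ?thesis
    unfolding nrm_square[OF f] nrm_square[OF g] nrm_square[OF fg] by simp
qed

lemma nrm_square_diff:
  assumes f: "f \<in> H" and g: "g \<in> H"
  shows "(nrm (f - g))\<^sup>2 = (nrm f)\<^sup>2 - 2 * Re (ip f g) + (nrm g)\<^sup>2"
proof -
  have g': "fun_scale (-1) g \<in> H" by (rule cfun.subspace_scale[OF subspace g])
  have "ip f (fun_scale (-1) g) = - ip f g" using ip_scale_right[OF g f, of "-1"] by simp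
  moreover have "nrm (fun_scale (-1) g) = nrm g" using nrm_scale[OF g, of "-1"] by simp
  ultimately show ?thesis
    unfolding diff_eq_scale nrm_square_add[OF f g'] by simp
qed

lemma nrm_0: "nrm 0 = 0"
  using nrm_zero_iff[OF cfun.subspace_0[OF subspace]] by simp

lemma nrm_diff_commute: "f \<in> H \<Longrightarrow> g \<in> H \<Longrightarrow> nrm (f - g) = nrm (g - f)"
  using nrm_scale[of "g - f" "-1"] by (simp add: fun_uminus_eq_scale[symmetric] cfun.subspace_diff[OF subspace])

lemma nrm_triangle_diff:
  "f \<in> H \<Longrightarrow> g \<in> H \<Longrightarrow> nrm f \<le> nrm (f - g) + nrm g"
  using nrm_add[of "f - g" g] by (simp add: cfun.subspace_diff[OF subspace])

end

lemma (in rkhs) Cauchy_convergent: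
  assumes p: "\<And>k. p k \<in> H"
    and Cauchy: "\<And>e. 0 < e \<Longrightarrow> \<exists>N. \<forall>j\<ge>N. \<forall>k\<ge>N. nrm (p j - p k) < e"
  obtains f where "f \<in> H" "(\<lambda>k. nrm (p k - f)) \<longlonglongrightarrow> 0"
proof -
  interpret m: Metric_space H "norm_dist H nrm" by (rule Metric_space_ip_norm)
  have "m.MCauchy p"
    unfolding m.MCauchy_def using p Cauchy by (auto simp: norm_dist_def)
  then obtain f where f: "limitin m.mtopology p f sequentially"
    using complete unfolding m.mcomplete_def by blast
  then have "f \<in> H" and lim: "\<And>e. 0 < e \<Longrightarrow> eventually (\<lambda>k. p k \<in> H \<and> norm_dist H nrm (p k) f < e) sequentially"
    unfolding m.limitin_metric by auto
  have "(\<lambda>k. nrm (p k - f)) \<longlonglongrightarrow> 0"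
  proof (rule tendstoI)
    fix e :: real assume "0 < e"
    from lim[OF this] show "eventually (\<lambda>k. dist (nrm (p k - f)) 0 < e) sequentially"
      by eventually_elim
        (use \<open>f \<in> H\<close> in \<open>auto simp: norm_dist_def nrm_nonneg cfun.subspace_diff[OF subspace]\<close>)
  qed
  with \<open>f \<in> H\<close> show ?thesis by (rule that)
qed

text \<open>Concatenation of two lists of coefficients and points. One concatenation works for all
  \<open>F\<close>, so it serves a combination of kernels and the value of a functional on it at the
  same time.\<close>

lemma sum_append:
  fixes c d :: "nat \<Rightarrow> complex" and x y :: "nat \<Rightarrow> 'a"
  shows "\<exists>(N::nat) e w. \<forall>F. (\<Sum>i<N. e i * F (w i)) = (\<Sum>i<n. c i * F (x i)) + (\<Sum>i<m. d i * F (y i))"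
proof (intro exI allI)
  fix F :: "'a \<Rightarrow> complex"
  define e where "e i = (if i < n then c i else d (i - n))" for i
  define w where "w i = (if i < n then x i else y (i - n))" for i
  have "(\<Sum>i<n+m. e i * F (w i)) = (\<Sum>i<n. e i * F (w i)) + (\<Sum>i<m. e (i + n) * F (w (i + n)))"
    using sum.atLeastLessThan_concat[of 0 n "n + m" "\<lambda>i. e i * F (w i)"]
      sum.shift_bounds_nat_ivl[of "\<lambda>i. e i * F (w i)" 0 n m]
    by (simp add: atLeast0LessThan add.commute)
  then show "(\<Sum>i<n+m. (if i < n then c i else d (i - n)) * F (if i < n then x i else y (i - n)))
      = (\<Sum>i<n. c i * F (x i)) + (\<Sum>i<m. d i * F (y i))"
    by (simp add: e_def w_def)
qed

locale rkhs_with_kernel = rkhs H ip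
  for H :: "('a \<Rightarrow> complex) set"
    and ip :: "('a \<Rightarrow> complex) \<Rightarrow> ('a \<Rightarrow> complex) \<Rightarrow> complex" +
  fixes K :: "'a \<Rightarrow> 'a \<Rightarrow> complex"
  assumes kernel: "reproducing_kernel H ip K"
begin

abbreviation ker :: "'a \<Rightarrow> 'a \<Rightarrow> complex" where "ker w \<equiv> \<lambda>z. K z w"

lemma ker_in: "ker w \<in> H"
  using kernel by (simp add: reproducing_kernel_def)

lemma reproducing: "f \<in> H \<Longrightarrow> ip f (ker w) = f w"
  using kernel by (simp add: reproducing_kernel_def)

lemma K_cnj: "cnj (K z w) = K w z"
  using ip_cnj[OF ker_in ker_in, of w z] by (simp add: reproducing ker_in)

lemma nrm_ker: "(nrm (ker z))\<^sup>2 = Re (K z z)"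
  by (simp add: nrm_square ker_in reproducing)

lemma evaluation_le: "f \<in> H \<Longrightarrow> cmod (f z) \<le> nrm f * nrm (ker z)"
  using Cauchy_Schwarz[OF _ ker_in, of f z] by (simp add: reproducing)

definition comb :: "nat \<Rightarrow> (nat \<Rightarrow> complex) \<Rightarrow> (nat \<Rightarrow> 'a) \<Rightarrow> 'a \<Rightarrow> complex" where
  "comb n c x = (\<lambda>z. \<Sum>i<n. c i * K z (x i))"

lemma comb_Suc: "comb (Suc n) c x = comb n c x + fun_scale (c n) (ker (x n))"
  by (simp add: comb_def fun_scale_def fun_eq_iff)

lemma comb_in: "comb n c x \<in> H"
proof (induction n)
  case 0
  then show ?case using cfun.subspace_0[OF subspace] by (simp add: comb_def zero_fun_def)
next
  case (Suc n)
  then show ?case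
    unfolding comb_Suc by (intro cfun.subspace_add cfun.subspace_scale subspace ker_in)
qed

lemma ip_comb: "f \<in> H \<Longrightarrow> ip f (comb n c x) = (\<Sum>i<n. cnj (c i) * f (x i))"
proof (induction n)
  case 0
  then show ?case
    using ip_scale_right[of 0 f 0] cfun.subspace_0[OF subspace]
    by (simp add: comb_def zero_fun_def fun_scale_def)
next
  case (Suc n)
  then show ?case
    unfolding comb_Suc ip_add_right[OF comb_in cfun.subspace_scale[OF subspace ker_in] Suc.prems]
      ip_scale_right[OF ker_in Suc.prems] reproducing[OF Suc.prems] by simp
qed

lemma nrm_comb: "(nrm (comb n c x))\<^sup>2 = Re (\<Sum>i<n. \<Sum>j<n. cnj (c i) * c j * K (x i) (x j))"
  unfolding nrm_square[OF comb_in] ip_comb[OF comb_in]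
  by (simp add: comb_def sum_distrib_left mult.assoc)

text \<open>
  A function whose associated functional \<open>k\<^sub>z \<mapsto> cnj (u z)\<close> on combinations \<open>p\<close> of kernels is bounded
  is the limit of a minimising sequence of the coercive functional \<open>\<parallel>p\<parallel>\<^sup>2 - 2 Re l(p)\<close>. This gives the
  membership criterion and the density of the kernels at once, without orthogonal projections.
\<close>

lemma bounded_functional:
  assumes C: "0 \<le> C"
    and bound: "\<And>n c x. cmod (\<Sum>i<n. c i * cnj (u (x i))) \<le> C * nrm (comb n c x)"
  shows "u \<in> H" and "nrm u \<le> C" and "0 < e \<Longrightarrow> \<exists>n c x. nrm (u - comb n c x) < e"
proof -
  \<comment> \<open>A combination may have several representations, so the functional is kept as a
    relation between \<open>p\<close> and its value \<open>l\<close>.\<close>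
  define Q where "Q p l \<longleftrightarrow> (\<exists>n c x. p = comb n c x \<and> l = (\<Sum>i<n. c i * cnj (u (x i))))" for p l
  define J where "J p l = (nrm p)\<^sup>2 - 2 * Re l" for p :: "'a \<Rightarrow> complex" and l
  have Q_in: "p \<in> H" if "Q p l" for p l using that comb_in by (auto simp: Q_def)
  have Q_bound: "cmod l \<le> C * nrm p" if "Q p l" for p l using that bound by (auto simp: Q_def)
  have Q_add: "Q (p + p') (l + l')" if Q: "Q p l" "Q p' l'" for p l p' l'
  proof -
    obtain n c x m d y where 1: "p = comb n c x" "l = (\<Sum>i<n. c i * cnj (u (x i)))"
      and 2: "p' = comb m d y" "l' = (\<Sum>i<m. d i * cnj (u (y i)))"
      using Q by (auto simp: Q_def)
    obtain N :: nat and e w where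
      *: "\<And>F. (\<Sum>i<N. e i * F (w i)) = (\<Sum>i<n. c i * F (x i)) + (\<Sum>i<m. d i * F (y i))"
      using sum_append[where n = n and c = c and x = x and m = m and d = d and y = y] by blast
    have "p + p' = comb N e w" by (simp add: 1 2 comb_def fun_eq_iff *)
    moreover have "l + l' = (\<Sum>i<N. e i * cnj (u (w i)))" unfolding 1 2 *[of "\<lambda>a. cnj (u a)"] ..
    ultimately show ?thesis unfolding Q_def by blast
  qed
  have Q_scale: "Q (fun_scale a p) (a * l)" if Q: "Q p l" for p l a
  proof -
    obtain n c x where "p = comb n c x" "l = (\<Sum>i<n. c i * cnj (u (x i)))"
      using Q by (auto simp: Q_def)
    then have "fun_scale a p = comb n (\<lambda>i. a * c i) x" "a * l = (\<Sum>i<n. (a * c i) * cnj (u (x i)))"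
      by (simp_all add: comb_def fun_scale_def fun_eq_iff sum_distrib_left mult.assoc)
    then show ?thesis unfolding Q_def by blast
  qed
  have Q_ker: "Q (ker z) (cnj (u z))" for z
    unfolding Q_def comb_def by (intro exI[of _ 1] exI[of _ "\<lambda>_. 1"] exI[of _ "\<lambda>_. z"]) simp
  have Q_0: "Q 0 0" unfolding Q_def comb_def by (intro exI[of _ 0]) (simp add: zero_fun_def)
  define m where "m = Inf {J p l | p l. Q p l}"
  have J_ge: "- (C\<^sup>2) \<le> J p l" if "Q p l" for p l
  proof -
    have "Re l \<le> C * nrm p" using Q_bound[OF that] complex_Re_le_cmod[of l] by linarith
    moreover have "0 \<le> (nrm p - C)\<^sup>2" by simp
    ultimately show ?thesis unfolding J_def power2_diff by (simp add: mult.commute)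
  qed
  have m_le: "m \<le> J p l" if "Q p l" for p l
    unfolding m_def by (rule cInf_lower) (use that J_ge in \<open>auto intro!: bdd_belowI[of _ "- (C\<^sup>2)"]\<close>)
  have "\<exists>p l. Q p l \<and> J p l < m + 1 / real (Suc k)" for k
    using cInf_lessD[of "{J p l | p l. Q p l}" "m + 1 / real (Suc k)"] Q_0
    unfolding m_def by fastforce
  then obtain p l where Q: "\<And>k. Q (p k) (l k)" and J: "\<And>k. J (p k) (l k) < m + 1 / real (Suc k)"
    by metis
  have p: "p k \<in> H" for k by (rule Q_in[OF Q])
  \<comment> \<open>Parallelogram law: \<open>J\<close> is at least \<open>m\<close> at the midpoint
    of \<open>p j\<close> and \<open>p k\<close>, so two almost minimal elements are close.\<close>
  have close: "(nrm (p j - p k))\<^sup>2 \<le> 2 / real (Suc j) + 2 / real (Suc k)" for j k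
  proof -
    have sum_in: "p j + p k \<in> H" by (rule cfun.subspace_add[OF subspace p p])
    have "m \<le> J (fun_scale (1/2) (p j + p k)) ((1/2) * (l j + l k))"
      by (intro m_le Q_scale Q_add Q)
    also have "\<dots> = (nrm (p j + p k))\<^sup>2 / 4 - Re (l j + l k)"
      unfolding J_def nrm_scale[OF sum_in] by (simp add: power_mult_distrib power_divide field_simps)
    finally have "4 * m \<le> (nrm (p j + p k))\<^sup>2 - 4 * Re (l j) - 4 * Re (l k)" by simp
    then show ?thesis
      using J[of j] J[of k] unfolding nrm_square_add[OF p p] nrm_square_diff[OF p p] J_def by simp
  qed
  obtain f where f: "f \<in> H" and lim: "(\<lambda>k. nrm (p k - f)) \<longlonglongrightarrow> 0"
  proof (rule Cauchy_convergent[OF p])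
    fix e :: real assume e: "0 < e"
    obtain N where N: "4 / e\<^sup>2 < real N" using reals_Archimedean2 by blast
    have small: "2 / real (Suc j) < e\<^sup>2 / 2" if "j \<ge> N" for j
    proof -
      have "4 / e\<^sup>2 < real (Suc j)" using N that by linarith
      then show ?thesis using e by (simp add: field_simps)
    qed
    have "nrm (p j - p k) < e" if "j \<ge> N" "k \<ge> N" for j k
    proof (rule power2_less_imp_less)
      show "(nrm (p j - p k))\<^sup>2 < e\<^sup>2"
        using close[of j k] small[OF that(1)] small[OF that(2)] by linarith
    qed (use e in simp)
    then show "\<exists>N. \<forall>j\<ge>N. \<forall>k\<ge>N. nrm (p j - p k) < e" by blast
  qed
  have "f z = u z" for z
  proof -
    \<comment> \<open>Minimality is tested along the kernel at \<open>z\<close>. With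
      \<open>t = - \<epsilon> d\<close> the first order term is \<open>-2 \<epsilon>\<close> and the
      second order term \<open>\<epsilon>\<^sup>2 * \<kappa>\<close> times the square of the modulus
      of \<open>d\<close>; for \<open>\<epsilon> = 1 / (\<kappa> + 1)\<close> the former dominates,
      which forces \<open>d = 0\<close>.\<close>
    define d where "d = f z - u z"
    define \<kappa> where "\<kappa> = (nrm (ker z))\<^sup>2"
    define \<epsilon> where "\<epsilon> = 1 / (\<kappa> + 1)"
    define t where "t = - of_real \<epsilon> * d"
    have "(\<lambda>k. p k z - f z) \<longlonglongrightarrow> 0"
    proof (rule Lim_null_comparison)
      show "\<forall>\<^sub>F k in sequentially. cmod (p k z - f z) \<le> nrm (p k - f) * nrm (ker z)"
        using evaluation_le[OF cfun.subspace_diff[OF subspace p f], of _ z] by simp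
      show "(\<lambda>k. nrm (p k - f) * nrm (ker z)) \<longlonglongrightarrow> 0"
        using tendsto_mult_left_zero[OF lim] .
    qed
    then have pz: "(\<lambda>k. p k z) \<longlonglongrightarrow> f z" by (simp add: LIM_zero_iff)
    have "0 \<le> 1 / real (Suc k) + 2 * Re (cnj t * (p k z - u z)) + (cmod t)\<^sup>2 * \<kappa>" for k
    proof -
      have tk: "fun_scale t (ker z) \<in> H" by (rule cfun.subspace_scale[OF subspace ker_in])
      have "m \<le> J (p k + fun_scale t (ker z)) (l k + t * cnj (u z))"
        by (intro m_le Q_scale Q_add Q Q_ker)
      also have "\<dots> = J (p k) (l k) + 2 * Re (cnj t * p k z) + (cmod t)\<^sup>2 * \<kappa> - 2 * Re (t * cnj (u z))"
        by (simp add: J_def nrm_square_add p tk ip_scale_right ker_in reproducing nrm_scale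
            power_mult_distrib \<kappa>_def)
      finally show ?thesis using J[of k] by (simp add: algebra_simps)
    qed
    moreover have "(\<lambda>k. 1 / real (Suc k) + 2 * Re (cnj t * (p k z - u z)) + (cmod t)\<^sup>2 * \<kappa>)
        \<longlonglongrightarrow> 0 + 2 * Re (cnj t * (f z - u z)) + (cmod t)\<^sup>2 * \<kappa>"
      by (intro tendsto_intros pz LIMSEQ_inverse_real_of_nat[unfolded inverse_eq_divide])
    ultimately have "0 \<le> 0 + 2 * Re (cnj t * (f z - u z)) + (cmod t)\<^sup>2 * \<kappa>"
      by (intro LIMSEQ_le_const) auto
    moreover have "Re (cnj t * (f z - u z)) = - \<epsilon> * (cmod d)\<^sup>2"
      unfolding t_def d_def[symmetric] cmod_power2 by (simp add: power2_eq_square algebra_simps)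
    moreover have "(cmod t)\<^sup>2 = \<epsilon>\<^sup>2 * (cmod d)\<^sup>2"
      by (simp add: t_def norm_mult power_mult_distrib)
    ultimately have "0 \<le> \<epsilon> * (cmod d)\<^sup>2 * (\<epsilon> * \<kappa> - 2)" by (simp add: power2_eq_square algebra_simps)
    moreover have "0 \<le> \<kappa>" by (simp add: \<kappa>_def)
    then have "0 < \<epsilon>" "\<epsilon> * \<kappa> - 2 < 0" by (auto simp: \<epsilon>_def divide_simps)
    ultimately have "(cmod d)\<^sup>2 \<le> 0"
      by (simp add: zero_le_mult_iff mult_le_0_iff)
    then show ?thesis by (simp add: d_def)
  qed
  then have fu: "f = u" by (simp add: fun_eq_iff)
  then show u: "u \<in> H" using f by simp
  have approx: "\<exists>k. nrm (u - p k) < e" if "0 < e" for e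
  proof -
    have "eventually (\<lambda>k. nrm (p k - f) < e) sequentially"
      using order_tendstoD(2)[OF lim that] .
    then show ?thesis
      using nrm_diff_commute[OF p u] fu eventually_happens'[OF sequentially_bot] by metis
  qed
  show "\<exists>n c x. nrm (u - comb n c x) < e" if "0 < e" for e
    using approx[OF that] Q unfolding Q_def by metis
  \<comment> \<open>The inner product of \<open>u\<close> with \<open>p k\<close> is the conjugate
    of the functional at \<open>p k\<close>, hence at most \<open>C * nrm (p k)\<close> in modulus;
    the rest is an error of order \<open>e\<close>.\<close>
  have "(nrm u)\<^sup>2 \<le> C * nrm u + e * (C + nrm u)" if e: "0 < e" for e
  proof -
    obtain k where k: "nrm (u - p k) < e" using approx[OF e] by blast
    have up: "u - p k \<in> H" by (rule cfun.subspace_diff[OF subspace u p])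
    have "ip u (p k) = cnj (l k)"
      using Q[of k] ip_comb[OF u] by (auto simp: Q_def)
    then have "cmod (ip u (p k)) \<le> C * nrm (p k)" using Q_bound[OF Q] by simp
    also have "\<dots> \<le> C * (nrm u + e)"
      using nrm_triangle_diff[OF p u, of k] k nrm_diff_commute[OF u p, of k] C
      by (intro mult_left_mono) auto
    finally have 1: "cmod (ip u (p k)) \<le> C * (nrm u + e)" .
    have "cmod (ip u (u - p k)) \<le> nrm u * e"
      using Cauchy_Schwarz[OF u up] k nrm_nonneg[OF u]
      by (meson less_eq_real_def mult_left_mono order_trans)
    moreover have "ip u u = ip u (p k) + ip u (u - p k)" by (simp add: ip_diff_right u p)
    then have "Re (ip u u) \<le> cmod (ip u (p k) + ip u (u - p k))" by (metis complex_Re_le_cmod)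
    ultimately have "Re (ip u u) \<le> C * (nrm u + e) + nrm u * e"
      using 1 norm_triangle_ineq[of "ip u (p k)" "ip u (u - p k)"] by linarith
    then show ?thesis by (simp add: nrm_square[OF u] algebra_simps)
  qed
  note le = this
  have "(nrm u)\<^sup>2 \<le> C * nrm u"
  proof (rule field_le_epsilon)
    fix e :: real assume e: "0 < e"
    have pos: "0 < C + nrm u + 1" using C nrm_nonneg[OF u] by linarith
    have "e / (C + nrm u + 1) * (C + nrm u) \<le> e"
      using e pos by (simp add: field_simps)
    then show "(nrm u)\<^sup>2 \<le> C * nrm u + e"
      using le[of "e / (C + nrm u + 1)"] e pos by simp
  qed
  then show "nrm u \<le> C"
    using nrm_nonneg[OF u] C by (cases "nrm u = 0") (simp_all add: power2_eq_square)
qed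

lemma comb_dense:
  assumes f: "f \<in> H" and "0 < e"
  obtains n c x where "nrm (f - comb n c x) < e"
proof -
  have "cmod (\<Sum>i<n. c i * cnj (f (x i))) \<le> nrm f * nrm (comb n c x)" for n c x
  proof -
    have "cmod (ip f (comb n c x)) = cmod (cnj (\<Sum>i<n. c i * cnj (f (x i))))"
      by (simp add: ip_comb[OF f])
    then show ?thesis using Cauchy_Schwarz[OF f comb_in, of n c x] by (simp only: complex_mod_cnj)
  qed
  from bounded_functional(3)[OF nrm_nonneg[OF f] this \<open>0 < e\<close>] show ?thesis using that by blast
qed

text \<open>The adjoint of the row sends \<open>comb n c x\<close> to the combinations with
  coefficients \<open>c i * cnj (\<phi> k (x i))\<close>. The positivity hypothesis bounds their
  square sum by \<open>C\<^sup>2 * (nrm (comb n c x))\<^sup>2\<close>, so the functional of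
  \<open>u\<close> is bounded by Cauchy-Schwarz, and \<open>bounded_functional\<close>
  applies.\<close>

lemma row_multiplier:
  assumes C: "0 \<le> C"
    and pos: "\<And>N. pos_kernel (\<lambda>z w. of_real (C\<^sup>2) * K z w - (\<Sum>k<N. \<phi> k z * cnj (\<phi> k w)) * K z w)"
    and g: "\<And>k. g k \<in> H" and summable: "summable (\<lambda>k. (nrm (g k))\<^sup>2)"
    and u: "\<And>x. (\<lambda>k. \<phi> k x * g k x) sums u x"
  shows "u \<in> H" and "nrm u \<le> C * sqrt (\<Sum>k. (nrm (g k))\<^sup>2)"
proof -
  let ?G = "\<Sum>k. (nrm (g k))\<^sup>2"
  have "cmod (\<Sum>i<n. c i * cnj (u (x i))) \<le> C * sqrt ?G * nrm (comb n c x)" for n c x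
  proof -
    define q where "q k = comb n (\<lambda>i. c i * cnj (\<phi> k (x i))) x" for k
    have q: "q k \<in> H" for k by (simp add: q_def comb_in)
    have "(\<lambda>k. \<Sum>i<n. cnj (c i) * (\<phi> k (x i) * g k (x i))) sums (\<Sum>i<n. cnj (c i) * u (x i))"
      by (intro sums_sum sums_mult u)
    then have lim: "(\<lambda>N. \<Sum>k<N. ip (g k) (q k)) \<longlonglongrightarrow> (\<Sum>i<n. cnj (c i) * u (x i))"
      by (simp add: sums_def q_def ip_comb g mult.assoc)
    have "cmod (\<Sum>k<N. ip (g k) (q k)) \<le> C * sqrt ?G * nrm (comb n c x)" for N
    proof -
      have "(\<Sum>k<N. (nrm (q k))\<^sup>2)
          = Re (\<Sum>k<N. \<Sum>i<n. \<Sum>j<n. cnj (c i) * c j * (\<phi> k (x i) * cnj (\<phi> k (x j)) * K (x i) (x j)))"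
        by (simp add: q_def nrm_comb mult_ac del: times_complex.sel)
      also have "(\<Sum>k<N. \<Sum>i<n. \<Sum>j<n. cnj (c i) * c j * (\<phi> k (x i) * cnj (\<phi> k (x j)) * K (x i) (x j)))
          = (\<Sum>i<n. \<Sum>j<n. cnj (c i) * c j * ((\<Sum>k<N. \<phi> k (x i) * cnj (\<phi> k (x j))) * K (x i) (x j)))"
        by (subst sum.swap, rule sum.cong[OF refl], subst sum.swap)
          (simp add: sum_distrib_left sum_distrib_right)
      finally have 1: "(\<Sum>k<N. (nrm (q k))\<^sup>2) = Re \<dots>" .
      have "0 \<le> Re (\<Sum>i<n. \<Sum>j<n. cnj (c i) * cnj (cnj (c j)) *
        (of_real (C\<^sup>2) * K (x i) (x j) - (\<Sum>k<N. \<phi> k (x i) * cnj (\<phi> k (x j))) * K (x i) (x j)))"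
        by (rule psdD[OF pos_kernelD[OF pos]])
      also have "\<dots> = Re (of_real (C\<^sup>2) * (\<Sum>i<n. \<Sum>j<n. cnj (c i) * c j * K (x i) (x j)))
         - (\<Sum>k<N. (nrm (q k))\<^sup>2)"
        unfolding 1 by (simp add: right_diff_distrib sum_subtractf sum_distrib_left mult_ac
            del: times_complex.sel)
      finally have 2: "(\<Sum>k<N. (nrm (q k))\<^sup>2) \<le> (C * nrm (comb n c x))\<^sup>2"
        by (simp add: power_mult_distrib nrm_comb del: of_real_power)
      have "cmod (\<Sum>k<N. ip (g k) (q k)) \<le> (\<Sum>k<N. nrm (g k) * nrm (q k))"
        by (rule order_trans[OF norm_sum sum_mono[OF Cauchy_Schwarz[OF g q]]])
      also have "\<dots> \<le> sqrt ?G * (C * nrm (comb n c x))"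
      proof (rule power2_le_imp_le)
        have "(\<Sum>k<N. nrm (g k) * nrm (q k))\<^sup>2 \<le> (\<Sum>k<N. (nrm (g k))\<^sup>2) * (\<Sum>k<N. (nrm (q k))\<^sup>2)"
          by (rule Cauchy_Schwarz_ineq_sum)
        also have "\<dots> \<le> ?G * (C * nrm (comb n c x))\<^sup>2"
          using 2 summable by (intro mult_mono sum_le_suminf) (auto intro: sum_nonneg suminf_nonneg)
        finally show "(\<Sum>k<N. nrm (g k) * nrm (q k))\<^sup>2 \<le> (sqrt ?G * (C * nrm (comb n c x)))\<^sup>2"
          using summable by (simp add: power_mult_distrib suminf_nonneg)
      qed (use C nrm_nonneg[OF comb_in] summable in \<open>auto intro!: mult_nonneg_nonneg suminf_nonneg\<close>)
      finally show ?thesis by (simp add: mult_ac)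
    qed
    then have "cmod (\<Sum>i<n. cnj (c i) * u (x i)) \<le> C * sqrt ?G * nrm (comb n c x)"
      by (intro LIMSEQ_le_const2[OF tendsto_norm[OF lim]]) auto
    moreover have "(\<Sum>i<n. cnj (c i) * u (x i)) = cnj (\<Sum>i<n. c i * cnj (u (x i)))" by simp
    ultimately show ?thesis by (metis complex_mod_cnj)
  qed
  moreover have "0 \<le> C * sqrt ?G" using C summable by (simp add: suminf_nonneg)
  ultimately show "u \<in> H" "nrm u \<le> C * sqrt ?G" by (rule bounded_functional(1,2)[rotated])+
qed

text \<open>\<open>multipliers\<close> asks for invariance alone; the bound recorded here is what
  carries over to the weak product norm.\<close>

definition mult_bound :: "real \<Rightarrow> ('a \<Rightarrow> complex) \<Rightarrow> bool" where
  "mult_bound C \<phi> \<longleftrightarrow> 0 \<le> C \<and> (\<forall>f\<in>H. \<phi> * f \<in> H \<and> nrm (\<phi> * f) \<le> C * nrm f)"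

lemma mult_boundI:
  assumes C: "0 \<le> C"
    and pos: "pos_kernel (\<lambda>z w. of_real (C\<^sup>2) * K z w - \<phi> z * cnj (\<phi> w) * K z w)"
  shows "mult_bound C \<phi>"
proof -
  have "\<phi> * f \<in> H \<and> nrm (\<phi> * f) \<le> C * nrm f" if f: "f \<in> H" for f
  proof -
    \<comment> \<open>A single function is a row with one nonzero entry; its empty partial row,
      \<open>N = 0\<close>, leads to positivity of \<open>K\<close> itself.\<close>
    let ?\<phi> = "\<lambda>k::nat. if k = 0 then \<phi> else 0" and ?g = "\<lambda>k::nat. if k = 0 then f else 0"
    have K: "pos_kernel K"
      unfolding pos_kernel_def psd_def
    proof (intro allI)
      fix n x and c :: "nat \<Rightarrow> complex"
      have "0 \<le> (nrm (comb n (\<lambda>i. cnj (c i)) x))\<^sup>2" by simp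
      then show "0 \<le> Re (\<Sum>i<n. \<Sum>j<n. c i * cnj (c j) * K (x i) (x j))" unfolding nrm_comb by simp
    qed
    have row: "pos_kernel (\<lambda>z w. of_real (C\<^sup>2) * K z w - (\<Sum>k<N. ?\<phi> k z * cnj (?\<phi> k w)) * K z w)" for N
    proof (cases N)
      case 0
      then show ?thesis using pos_kernel_scale[OF K, of "C\<^sup>2"] by simp
    next
      case (Suc M)
      have "(\<Sum>k<N. ?\<phi> k z * cnj (?\<phi> k w)) = \<phi> z * cnj (\<phi> w)" for z w
        unfolding Suc sum.lessThan_Suc_shift by simp
      then show ?thesis using pos by simp
    qed
    have g: "(\<lambda>k. (nrm (?g k))\<^sup>2) sums ((nrm f)\<^sup>2)"
      using sums_single[of 0 "\<lambda>_. (nrm f)\<^sup>2"] by (rule back_subst[of "\<lambda>s. s sums _"]) (auto simp: nrm_0)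
    have u: "(\<lambda>k. ?\<phi> k x * ?g k x) sums (\<phi> * f) x" for x
    proof -
      have "(\<lambda>k. ?\<phi> k x * ?g k x) = (\<lambda>k. if k = 0 then \<phi> x * f x else 0)" by auto
      then show ?thesis using sums_single[of 0 "\<lambda>_. \<phi> x * f x"] by simp
    qed
    have g_in: "?g k \<in> H" for k using f cfun.subspace_0[OF subspace] by simp
    show ?thesis
      using row_multiplier[OF C row g_in sums_summable[OF g] u, folded sums_unique[OF g]] nrm_nonneg[OF f]
      by (simp add: func_times)
  qed
  then show ?thesis using C by (simp add: mult_bound_def)
qed

end


section \<open>Herglotz functions in complete Pick spaces\<close>

sublocale normalized_complete_pick_space \<subseteq> rkhs_with_kernel
  by unfold_locales (rule kernel)

context normalized_complete_pick_space
begin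

lemma ball_embedding:
  obtains b where "ball_embedding b" "K = ball_embedding.k b"
proof -
  obtain b :: "'a \<Rightarrow> nat \<Rightarrow> complex" where b: "range b \<subseteq> ell2_ball"
    and K: "\<forall>z w. K z w = 1 / (1 - ell2_inner (b z) (b w))"
    using normalized_pick by blast
  interpret ball_embedding b by unfold_locales (use b in auto)
  have "K = k" using K by (simp add: fun_eq_iff k_def s_def)
  then show ?thesis using that ball_embedding_axioms by blast
qed

lemma one_in: "1 \<in> H" and nrm_one: "nrm 1 = 1"
proof -
  obtain z0 where z0: "\<And>z. K z z0 = 1" using normalized_pick by blast
  then have one: "ker z0 = 1" by (simp add: fun_eq_iff)
  then show "1 \<in> H" using ker_in[of z0] by simp
  have "(nrm 1)\<^sup>2 = 1" using nrm_ker[of z0] one z0 by simp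
  then show "nrm 1 = 1" using nrm_nonneg[OF \<open>1 \<in> H\<close>] by (simp add: power2_eq_1_iff)
qed

lemma schur_pos_K: "schur_pos K"
  by (rule ball_embedding) (simp add: ball_embedding.schur_pos_k)

lemma schur_pos_K_minus_1: "schur_pos (\<lambda>z w. K z w - 1)"
  by (rule ball_embedding) (simp add: ball_embedding.schur_pos_k_minus_1)

lemma schur_pos_K_twisted:
  "schur_pos (\<lambda>(z, p) (w, q). K z w * K p q * (K z q + K p w - 1) - K z q * K p w * (K z w + K p q - 1))"
  by (rule ball_embedding) (simp add: ball_embedding.schur_pos_twisted)

lemma K_diagonal: "K z z = of_real ((nrm (ker z))\<^sup>2)" "1 \<le> (nrm (ker z))\<^sup>2"
proof -
  show "K z z = of_real ((nrm (ker z))\<^sup>2)"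
    using ip_self[OF ker_in, of z] by (simp add: reproducing ker_in)
  show "1 \<le> (nrm (ker z))\<^sup>2"
    using pos_kernel_diagonal[OF schur_pos_imp_pos[OF schur_pos_K_minus_1], of z] by (simp add: nrm_ker)
qed

lemma ker_mult_bound: "\<exists>C. mult_bound C (ker z)"
proof -
  obtain b where b: "ball_embedding b" "K = ball_embedding.k b" by (rule ball_embedding)
  obtain C where "0 \<le> C" "pos_kernel (\<lambda>w w'. of_real (C\<^sup>2) * K w w' - K w z * cnj (K w' z) * K w w')"
    using ball_embedding.k_multiplier_bound[OF b(1), of z] unfolding b(2) by blast
  then show ?thesis using mult_boundI[of C "ker z"] by blast
qed

text \<open>In the Hardy space of the disc this is the Herglotz integral of the squared modulus of
  the boundary values of \<open>f\<close>; its real part is their Poisson integral. The product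
  \<open>ker z * f\<close> lies in \<open>H\<close> for \<open>f\<close> in \<open>H\<close> by
  \<open>ker_mult_bound\<close>.\<close>

definition herglotz :: "('a \<Rightarrow> complex) \<Rightarrow> 'a \<Rightarrow> complex" where
  "herglotz f z = 2 * ip f (ker z * f) - of_real ((nrm f)\<^sup>2)"

text \<open>Continuity of this quadratic expression carries positivity from combinations of kernels
  to all of \<open>H\<close>, and the case \<open>g = 0\<close> makes the Herglotz functions of a
  square summable sequence summable. In \<open>2 * C + 1\<close>, the two halves of the polarized
  inner product give \<open>2 * C\<close> and the norms give 1.\<close>

lemma herglotz_lipschitz:
  "\<exists>D\<ge>0. \<forall>f\<in>H. \<forall>g\<in>H. cmod (herglotz f z - herglotz g z) \<le> D * nrm (f - g) * (nrm f + nrm g)"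
proof -
  obtain C where C: "mult_bound C (ker z)" using ker_mult_bound by blast
  then have C0: "0 \<le> C" and mult: "\<And>f. f \<in> H \<Longrightarrow> ker z * f \<in> H"
    and mult_le: "\<And>f. f \<in> H \<Longrightarrow> nrm (ker z * f) \<le> C * nrm f"
    by (auto simp: mult_bound_def)
  have "cmod (herglotz f z - herglotz g z) \<le> (2 * C + 1) * nrm (f - g) * (nrm f + nrm g)"
    if f: "f \<in> H" and g: "g \<in> H" for f g
  proof -
    have fg: "f - g \<in> H" by (rule cfun.subspace_diff[OF subspace f g])
    have "ker z * (f - g) = ker z * f - ker z * g" by (rule right_diff_distrib)
    then have "ip f (ker z * f) - ip g (ker z * g) = ip (f - g) (ker z * f) + ip g (ker z * (f - g))"
      by (simp only: ip_diff[OF f g mult[OF f]] ip_diff_right[OF mult[OF f] mult[OF g] g]) simp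
    then have eq: "herglotz f z - herglotz g z = 2 * ip (f - g) (ker z * f) + 2 * ip g (ker z * (f - g))
        - of_real ((nrm f - nrm g) * (nrm f + nrm g))"
      by (simp add: herglotz_def power2_eq_square algebra_simps)
    have "cmod (ip (f - g) (ker z * f)) \<le> nrm (f - g) * (C * nrm f)"
      using Cauchy_Schwarz[OF fg mult[OF f]] mult_left_mono[OF mult_le[OF f] nrm_nonneg[OF fg]] by linarith
    moreover have "cmod (ip g (ker z * (f - g))) \<le> nrm g * (C * nrm (f - g))"
      using Cauchy_Schwarz[OF g mult[OF fg]] mult_left_mono[OF mult_le[OF fg] nrm_nonneg[OF g]] by linarith
    moreover have "cmod (of_real ((nrm f - nrm g) * (nrm f + nrm g))) \<le> nrm (f - g) * (nrm f + nrm g)"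
    proof -
      have "\<bar>nrm f - nrm g\<bar> \<le> nrm (f - g)"
        using nrm_triangle_diff[OF f g] nrm_triangle_diff[OF g f] nrm_diff_commute[OF f g] by linarith
      then show ?thesis
        using nrm_nonneg[OF f] nrm_nonneg[OF g] unfolding norm_of_real abs_mult
        by (intro mult_mono) auto
    qed
    moreover have "cmod (herglotz f z - herglotz g z)
      \<le> 2 * cmod (ip (f - g) (ker z * f)) + 2 * cmod (ip g (ker z * (f - g)))
        + cmod (of_real ((nrm f - nrm g) * (nrm f + nrm g)))"
      unfolding eq
      by (rule order_trans[OF norm_triangle_ineq4 add_right_mono[OF order_trans[OF norm_triangle_ineq]]])
        (simp add: norm_mult)
    ultimately show ?thesis by (simp add: algebra_simps)
  qed
  then show ?thesis using C0 by (intro exI[of _ "2 * C + 1"]) auto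
qed

definition herglotz_const :: "'a \<Rightarrow> real" where
  "herglotz_const z = (SOME D. 0 \<le> D \<and>
     (\<forall>f\<in>H. \<forall>g\<in>H. cmod (herglotz f z - herglotz g z) \<le> D * nrm (f - g) * (nrm f + nrm g)))"

lemma herglotz_const_nonneg: "0 \<le> herglotz_const z"
  and herglotz_diff_le: "f \<in> H \<Longrightarrow> g \<in> H \<Longrightarrow>
    cmod (herglotz f z - herglotz g z) \<le> herglotz_const z * nrm (f - g) * (nrm f + nrm g)"
  using someI_ex[OF herglotz_lipschitz[of z]] unfolding herglotz_const_def by blast+

lemma herglotz_le: 
  assumes f: "f \<in> H" shows "cmod (herglotz f z) \<le> herglotz_const z * (nrm f)\<^sup>2"
proof -
  have 0: "0 \<in> H" by (rule cfun.subspace_0[OF subspace])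
  have "ip 0 g = 0" if "g \<in> H" for g using ip_diff[OF 0 0 that] by simp
  then have "herglotz 0 z = 0" by (simp add: herglotz_def nrm_0 0)
  then show ?thesis using herglotz_diff_le[OF f 0, of z] by (simp add: nrm_0 power2_eq_square)
qed

lemma herglotz_comb:
  "(herglotz (comb n c x) z + cnj (herglotz (comb n c x) w)) / 2
    = (\<Sum>i<n. \<Sum>j<n. c i * cnj (c j) * (K (x j) (x i) * (K z (x i) + K (x j) w - 1)))"
proof -
  let ?f = "comb n c x"
  have ip_comb_left: "ip ?f g = (\<Sum>i<n. c i * cnj (g (x i)))" if "g \<in> H" for g
    using ip_cnj[OF that comb_in, of n c x] by (simp add: ip_comb that)
  have mult: "ker z * ?f \<in> H" for z using ker_mult_bound[of z] comb_in by (auto simp: mult_bound_def)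
  have cnj_f: "cnj (?f u) = (\<Sum>j<n. cnj (c j) * K (x j) u)" for u
    by (simp add: comb_def K_cnj)
  have 1: "ip ?f (ker z * ?f) = (\<Sum>i<n. \<Sum>j<n. c i * cnj (c j) * (K (x j) (x i) * K z (x i)))" for z
    unfolding ip_comb_left[OF mult]
    by (simp add: K_cnj cnj_f sum_distrib_left mult_ac)
  have "cnj (ip ?f (ker w * ?f)) = (\<Sum>i<n. \<Sum>j<n. cnj (c i) * c j * (K (x i) (x j) * K (x i) w))"
    unfolding 1 by (simp add: K_cnj)
  \<comment> \<open>Conjugation interchanges the roles of \<open>i\<close> and \<open>j\<close>;
    renaming them restores the common coefficient.\<close>
  also have "\<dots> = (\<Sum>i<n. \<Sum>j<n. c i * cnj (c j) * (K (x j) (x i) * K (x j) w))"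
    by (subst sum.swap) (simp add: mult_ac)
  finally have 2: "cnj (ip ?f (ker w * ?f)) = \<dots>" .
  have 3: "of_real ((nrm ?f)\<^sup>2) = (\<Sum>i<n. \<Sum>j<n. c i * cnj (c j) * K (x j) (x i))"
    unfolding ip_self[OF comb_in, symmetric] ip_comb_left[OF comb_in]
    by (simp add: cnj_f sum_distrib_left mult_ac)
  have "(herglotz ?f z + cnj (herglotz ?f w)) / 2
      = ip ?f (ker z * ?f) + cnj (ip ?f (ker w * ?f)) - of_real ((nrm ?f)\<^sup>2)"
    by (simp add: herglotz_def)
  then show ?thesis
    unfolding 2 unfolding 1 3 by (simp add: algebra_simps sum.distrib sum_subtractf)
qed

text \<open>
  Written out for a combination of kernels, the inequality is a quadruple sum. After subtracting a
  term that is positive for product coefficients only, the remaining kernel on pairs factors as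
  \<open>(s z w * s p q - s z q * s p w) * (K z w * K z q * K p w * K p q)\<close> with \<open>K = 1 / (1 - s)\<close>.
\<close>

lemma herglotz_comb_pos:
  fixes c :: "nat \<Rightarrow> complex" and x :: "nat \<Rightarrow> 'a" and n :: nat
  defines "f \<equiv> comb n c x"
  shows "pos_kernel (\<lambda>z w. K z w * ((herglotz f z + cnj (herglotz f w)) / 2 - f z * cnj (f w)))"
  unfolding pos_kernel_def psd_def
proof (intro allI)
  fix m :: nat and y :: "nat \<Rightarrow> 'a" and d :: "nat \<Rightarrow> complex"
  define \<kappa> where "\<kappa> s t i j = K (y s) (y t) * K (x j) (x i) * (K (y s) (x i) + K (x j) (y t) - 1)
    - K (y s) (x i) * K (x j) (y t) * (K (y s) (y t) + K (x j) (x i) - 1)" for s t i j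
  define \<rho> where "\<rho> s t i j = K (y s) (x i) * K (x j) (y t) * (K (x j) (x i) - 1)" for s t i j
  have f: "f z * cnj (f w) = (\<Sum>i<n. \<Sum>j<n. c i * cnj (c j) * (K z (x i) * K (x j) w))" for z w
    unfolding f_def comb_def cnj_sum sum_product by (simp add: K_cnj mult_ac)
  have expand: "(\<Sum>s<m. \<Sum>t<m. d s * cnj (d t) * (K (y s) (y t) *
      ((herglotz f (y s) + cnj (herglotz f (y t))) / 2 - f (y s) * cnj (f (y t)))))
    = (\<Sum>s<m. \<Sum>t<m. \<Sum>i<n. \<Sum>j<n. d s * cnj (d t) * (c i * cnj (c j)) * (\<kappa> s t i j + \<rho> s t i j))"
    unfolding f herglotz_comb[of n c x, folded f_def] sum_subtractf[symmetric] sum_distrib_left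
    by (intro sum.cong refl) (simp add: \<kappa>_def \<rho>_def algebra_simps)
  \<comment> \<open>Product coefficients on the pairs \<open>(y s, x j)\<close>. The factor
    \<open>cnj (c j)\<close> is conjugated because \<open>x j\<close> is the first argument in
    \<open>K (x j) (x i)\<close>.\<close>
  have "0 \<le> Re (\<Sum>\<alpha>\<in>{..<m}\<times>{..<n}. \<Sum>\<beta>\<in>{..<m}\<times>{..<n}.
      (d (fst \<alpha>) * cnj (c (snd \<alpha>))) * cnj (d (fst \<beta>) * cnj (c (snd \<beta>))) *
      (\<lambda>(z, p) (w, q). K z w * K p q * (K z q + K p w - 1) - K z q * K p w * (K z w + K p q - 1))
        (y (fst \<alpha>), x (snd \<alpha>)) (y (fst \<beta>), x (snd \<beta>)))"
    by (intro pos_kernel_finite[OF schur_pos_imp_pos[OF schur_pos_K_twisted]]) auto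
  also have "(\<Sum>\<alpha>\<in>{..<m}\<times>{..<n}. \<Sum>\<beta>\<in>{..<m}\<times>{..<n}.
      (d (fst \<alpha>) * cnj (c (snd \<alpha>))) * cnj (d (fst \<beta>) * cnj (c (snd \<beta>))) *
      (\<lambda>(z, p) (w, q). K z w * K p q * (K z q + K p w - 1) - K z q * K p w * (K z w + K p q - 1))
        (y (fst \<alpha>), x (snd \<alpha>)) (y (fst \<beta>), x (snd \<beta>)))
    = (\<Sum>s<m. \<Sum>j<n. \<Sum>t<m. \<Sum>i<n. d s * cnj (d t) * (c i * cnj (c j)) * \<kappa> s t i j)"
    unfolding sum.cartesian_product' by (simp add: \<kappa>_def mult_ac)
  also have "\<dots> = (\<Sum>s<m. \<Sum>t<m. \<Sum>i<n. \<Sum>j<n. d s * cnj (d t) * (c i * cnj (c j)) * \<kappa> s t i j)"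
    by (rule sum.cong[OF refl], subst sum.swap, rule sum.cong[OF refl], rule sum.swap)
  finally have 1: "0 \<le> Re \<dots>" .
  \<comment> \<open>For product coefficients the sums over \<open>s\<close> and \<open>t\<close> in
    the \<rho> part separate and collapse into \<open>a\<close>, which leaves the positive kernel
    \<open>K - 1\<close>.\<close>
  define a where "a j = cnj (c j * (\<Sum>s<m. d s * K (y s) (x j)))" for j
  have a: "a j = cnj (c j) * (\<Sum>t<m. cnj (d t) * K (x j) (y t))" for j
    by (simp add: a_def K_cnj)
  have "0 \<le> Re (\<Sum>j<n. \<Sum>i<n. a j * cnj (a i) * (K (x j) (x i) - 1))"
    by (rule psdD[OF pos_kernelD[OF schur_pos_imp_pos[OF schur_pos_K_minus_1]]])
  also have "(\<Sum>j<n. \<Sum>i<n. a j * cnj (a i) * (K (x j) (x i) - 1))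
    = (\<Sum>j<n. \<Sum>i<n. \<Sum>s<m. \<Sum>t<m. d s * cnj (d t) * (c i * cnj (c j)) * \<rho> s t i j)"
  proof (intro sum.cong refl)
    fix i j
    have "a j * cnj (a i) = (c i * cnj (c j)) * ((\<Sum>s<m. d s * K (y s) (x i)) * (\<Sum>t<m. cnj (d t) * K (x j) (y t)))"
      unfolding a[of j] unfolding a_def by simp
    then show "a j * cnj (a i) * (K (x j) (x i) - 1)
      = (\<Sum>s<m. \<Sum>t<m. d s * cnj (d t) * (c i * cnj (c j)) * \<rho> s t i j)"
      unfolding sum_product by (simp add: sum_distrib_left sum_distrib_right \<rho>_def mult_ac)
  qed
  also have "\<dots> = (\<Sum>s<m. \<Sum>t<m. \<Sum>i<n. \<Sum>j<n. d s * cnj (d t) * (c i * cnj (c j)) * \<rho> s t i j)"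
  proof -
    let ?F = "\<lambda>j i s t. d s * cnj (d t) * (c i * cnj (c j)) * \<rho> s t i j"
    have "(\<Sum>j<n. \<Sum>i<n. \<Sum>s<m. \<Sum>t<m. ?F j i s t) = (\<Sum>i<n. \<Sum>j<n. \<Sum>s<m. \<Sum>t<m. ?F j i s t)"
      by (rule sum.swap)
    also have "\<dots> = (\<Sum>i<n. \<Sum>s<m. \<Sum>j<n. \<Sum>t<m. ?F j i s t)"
      by (rule sum.cong[OF refl], rule sum.swap)
    also have "\<dots> = (\<Sum>s<m. \<Sum>i<n. \<Sum>j<n. \<Sum>t<m. ?F j i s t)"
      by (rule sum.swap)
    also have "\<dots> = (\<Sum>s<m. \<Sum>i<n. \<Sum>t<m. \<Sum>j<n. ?F j i s t)"
      by (rule sum.cong[OF refl], rule sum.cong[OF refl], rule sum.swap)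
    also have "\<dots> = (\<Sum>s<m. \<Sum>t<m. \<Sum>i<n. \<Sum>j<n. ?F j i s t)"
      by (rule sum.cong[OF refl], rule sum.swap)
    finally show ?thesis .
  qed
  finally have 2: "0 \<le> Re \<dots>" .
  show "0 \<le> Re (\<Sum>s<m. \<Sum>t<m. d s * cnj (d t) * (K (y s) (y t) *
      ((herglotz f (y s) + cnj (herglotz f (y t))) / 2 - f (y s) * cnj (f (y t)))))"
    unfolding expand distrib_left sum.distrib plus_complex.sel using 1 2 by (rule add_nonneg_nonneg)
qed

lemma herglotz_pos:
  assumes f: "f \<in> H"
  shows "pos_kernel (\<lambda>z w. K z w * ((herglotz f z + cnj (herglotz f w)) / 2 - f z * cnj (f w)))"
proof -
  have "\<exists>n c x. nrm (f - comb n c x) < 1 / real (Suc k)" for k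
    using comb_dense[OF f, of "1 / real (Suc k)"] by fastforce
  then obtain n c x where *: "\<And>k. nrm (f - comb (n k) (c k) (x k)) < 1 / real (Suc k)" by metis
  define p where "p k = comb (n k) (c k) (x k)" for k
  have p: "p k \<in> H" for k by (simp add: p_def comb_in)
  have pf: "p k - f \<in> H" for k by (rule cfun.subspace_diff[OF subspace p f])
  have close: "nrm (p k - f) < 1 / real (Suc k)" for k
    using *[of k] nrm_diff_commute[OF f p, of k] by (simp add: p_def)
  have lim: "(\<lambda>k. nrm (p k - f)) \<longlonglongrightarrow> 0"
    by (rule Lim_null_comparison[OF _ LIMSEQ_inverse_real_of_nat[unfolded inverse_eq_divide]])
      (use close nrm_nonneg[OF pf] in \<open>auto intro!: always_eventually less_imp_le\<close>)
  have pz: "(\<lambda>k. p k z) \<longlonglongrightarrow> f z" for z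
  proof (rule LIM_zero_cancel, rule Lim_null_comparison)
    show "\<forall>\<^sub>F k in sequentially. cmod (p k z - f z) \<le> nrm (p k - f) * nrm (ker z)"
      using evaluation_le[OF pf, of _ z] by simp
    show "(\<lambda>k. nrm (p k - f) * nrm (ker z)) \<longlonglongrightarrow> 0"
      using tendsto_mult_left_zero[OF lim] .
  qed
  have hz: "(\<lambda>k. herglotz (p k) z) \<longlonglongrightarrow> herglotz f z" for z
  proof (rule LIM_zero_cancel, rule Lim_null_comparison)
    show "\<forall>\<^sub>F k in sequentially. cmod (herglotz (p k) z - herglotz f z)
        \<le> nrm (p k - f) * (herglotz_const z * (2 * nrm f + 1))"
    proof (rule always_eventually, rule allI)
      fix k
      have "1 / real (Suc k) \<le> 1" by simp
      then have "nrm (p k) + nrm f \<le> 2 * nrm f + 1"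
        using nrm_triangle_diff[OF p f, of k] close[of k] by linarith
      then have "herglotz_const z * nrm (p k - f) * (nrm (p k) + nrm f)
          \<le> herglotz_const z * nrm (p k - f) * (2 * nrm f + 1)"
        by (intro mult_left_mono mult_nonneg_nonneg herglotz_const_nonneg nrm_nonneg[OF pf])
      then show "cmod (herglotz (p k) z - herglotz f z)
          \<le> nrm (p k - f) * (herglotz_const z * (2 * nrm f + 1))"
        using herglotz_diff_le[OF p f, of k z] by (simp add: mult_ac)
    qed
    show "(\<lambda>k. nrm (p k - f) * (herglotz_const z * (2 * nrm f + 1))) \<longlonglongrightarrow> 0"
      using tendsto_mult_left_zero[OF lim] .
  qed
  show ?thesis
  proof (rule pos_kernel_limit)
    show "(\<lambda>k. K z w * ((herglotz (p k) z + cnj (herglotz (p k) w)) / 2 - p k z * cnj (p k w)))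
        \<longlonglongrightarrow> K z w * ((herglotz f z + cnj (herglotz f w)) / 2 - f z * cnj (f w))" for z w
      by (intro tendsto_intros pz hz) simp
    show "pos_kernel (\<lambda>z w. K z w * ((herglotz (p k) z + cnj (herglotz (p k) w)) / 2 - p k z * cnj (p k w)))" for k
      unfolding p_def by (rule herglotz_comb_pos)
  qed
qed

text \<open>With \<open>P = 1 + t V\<close> and \<open>\<xi> = 1 / P\<close>, the cross term of
  \<open>P z * cnj (P w)\<close> is \<open>2 t\<close> times the real part kernel of
  \<open>V\<close>. Positivity of that term and of the quadratic one makes \<xi> a contraction;
  comparing it with the rank one terms of the \<open>f k\<close> bounds the row
  \<open>\<xi> * f k\<close> by \<open>sqrt (1 / (2 * t))\<close>. Since \<open>P\<close> has real
  part at least 1, \<open>\<xi> - 1\<close> is at most \<open>t\<close> times \<open>V\<close> in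
  modulus.\<close>

lemma regularizer:
  assumes f: "\<And>n. f n \<in> H" and summable: "summable (\<lambda>n. (nrm (f n))\<^sup>2)" and t: "0 < t"
  obtains \<xi> where "mult_bound 1 \<xi>"
    "\<And>z. cmod (\<xi> z - 1) \<le> t * herglotz_const z * (\<Sum>n. (nrm (f n))\<^sup>2)"
    "\<And>g u. (\<And>n. g n \<in> H) \<Longrightarrow> summable (\<lambda>n. (nrm (g n))\<^sup>2) \<Longrightarrow> (\<And>x. (\<lambda>n. f n x * g n x) sums u x)
      \<Longrightarrow> \<xi> * u \<in> H \<and> nrm (\<xi> * u) \<le> sqrt (1 / (2 * t)) * sqrt (\<Sum>n. (nrm (g n))\<^sup>2)"
proof -
  define V where "V z = (\<Sum>n. herglotz (f n) z)" for z
  have V_abs: "summable (\<lambda>n. cmod (herglotz (f n) z))" for z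
    by (rule summable_comparison_test[OF _ summable_mult[OF summable, of "herglotz_const z"]])
      (use herglotz_le[OF f] in auto)
  have V_sums: "(\<lambda>n. herglotz (f n) z) sums V z" for z
    unfolding V_def by (rule summable_sums[OF summable_norm_cancel[OF V_abs]])
  have V_le: "cmod (V z) \<le> herglotz_const z * (\<Sum>n. (nrm (f n))\<^sup>2)" for z
    unfolding V_def suminf_mult[OF summable, symmetric]
    by (intro norm_suminf_le summable_mult summable herglotz_le f)
  \<comment> \<open>All \<open>f k\<close> contribute to \<open>V\<close>, but only the rank one
    terms with \<open>k < N\<close> are subtracted; for the other \<open>k\<close> the rank one term
    is added back to \<open>herglotz_pos\<close>.\<close>
  have V_pos: "pos_kernel (\<lambda>z w. K z w * ((V z + cnj (V w)) / 2 - (\<Sum>k<N. f k z * cnj (f k w))))" for N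
  proof (rule pos_kernel_sums)
    show "(\<lambda>k. K z w * ((herglotz (f k) z + cnj (herglotz (f k) w)) / 2
          - (if k \<in> {..<N} then f k z * cnj (f k w) else 0)))
        sums (K z w * ((V z + cnj (V w)) / 2 - (\<Sum>k<N. f k z * cnj (f k w))))" for z w
      by (intro sums_mult sums_diff sums_divide sums_add V_sums sums_cnj[THEN iffD2] sums_If_finite_set) simp
    show "pos_kernel (\<lambda>z w. K z w * ((herglotz (f k) z + cnj (herglotz (f k) w)) / 2
          - (if k \<in> {..<N} then f k z * cnj (f k w) else 0)))" for k
    proof (cases "k < N")
      case True
      then show ?thesis using herglotz_pos[OF f[of k]] by simp
    next
      case False
      have eq: "k * (a - b) + b * k = k * (a - 0)" for a b k :: complex
        by (simp add: algebra_simps)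
      show ?thesis
        using pos_kernel_add[OF herglotz_pos[OF f[of k]]
            pos_kernel_rank_one[OF schur_pos_imp_pos[OF schur_pos_K], of "f k"]] False
        unfolding eq by simp
    qed
  qed
  have Re_V: "0 \<le> Re (V z)" for z
  proof -
    have "0 \<le> Re (K z z * ((V z + cnj (V z)) / 2))"
      using pos_kernel_diagonal[OF V_pos[of 0], of z] by simp
    also have "\<dots> = (nrm (ker z))\<^sup>2 * Re (V z)"
      by (subst K_diagonal(1)) (simp add: complex_add_cnj del: of_real_power)
    finally show ?thesis using K_diagonal(2)[of z] by (auto simp: zero_le_mult_iff)
  qed
  define P where "P z = 1 + of_real t * V z" for z
  define \<xi> where "\<xi> z = 1 / P z" for z
  have P_ge: "1 \<le> cmod (P z)" for z
  proof -
    have "1 \<le> Re (P z)" using Re_V[of z] t by (simp add: P_def)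
    then show ?thesis using complex_Re_le_cmod[of "P z"] by linarith
  qed
  then have P0: "P z \<noteq> 0" for z by (metis norm_zero not_one_le_zero)
  have pos: "pos_kernel (\<lambda>z w. \<xi> z * cnj (\<xi> w) * (of_real (t\<^sup>2) * (V z * cnj (V w) * K z w) +
      of_real (2 * t) * (K z w * ((V z + cnj (V w)) / 2 - (\<Sum>k<N. f k z * cnj (f k w))))))" for N
    by (intro pos_kernel_rank_one pos_kernel_add pos_kernel_scale V_pos schur_pos_imp_pos[OF schur_pos_K])
      (use t in auto)
  have P: "P z * cnj (P w)
      = 1 + of_real (2 * t) * ((V z + cnj (V w)) / 2) + of_real (t\<^sup>2) * (V z * cnj (V w))" for z w
    by (simp add: P_def power2_eq_square distrib_left distrib_right)
  have expand: "x * (T\<^sub>2 * (B * k) + T\<^sub>1 * (k * (A - S))) + x * k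
      = x * (1 + T\<^sub>1 * A + T\<^sub>2 * B) * k - T\<^sub>1 * (x * S * k)" for x k A B S T\<^sub>1 T\<^sub>2 :: complex
    by (simp add: algebra_simps)
  have \<xi>P: "\<xi> z * cnj (\<xi> w) * (P z * cnj (P w)) = 1" for z w
    using P0 by (simp add: \<xi>_def)
  show ?thesis
  proof (rule that)
    show "mult_bound 1 \<xi>"
    proof (rule mult_boundI)
      have "\<xi> z * cnj (\<xi> w) * (of_real (t\<^sup>2) * (V z * cnj (V w) * K z w) +
          of_real (2 * t) * (K z w * ((V z + cnj (V w)) / 2 - (\<Sum>k<0. f k z * cnj (f k w)))))
        = \<xi> z * cnj (\<xi> w) * (P z * cnj (P w)) * K z w - \<xi> z * cnj (\<xi> w) * K z w" for z w
        unfolding P eq_diff_eq expand by simp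
      then show "pos_kernel (\<lambda>z w. of_real (1\<^sup>2) * K z w - \<xi> z * cnj (\<xi> w) * K z w)"
        using pos[of 0] unfolding \<xi>P by simp
    qed simp
    show "cmod (\<xi> z - 1) \<le> t * herglotz_const z * (\<Sum>n. (nrm (f n))\<^sup>2)" for z
    proof -
      have "\<xi> z - 1 = - (of_real t * V z) / P z" using P0[of z] by (simp add: \<xi>_def P_def field_simps)
      then have "cmod (\<xi> z - 1) = t * cmod (V z) / cmod (P z)" using t by (simp add: norm_mult norm_divide)
      also have "\<dots> \<le> t * cmod (V z) / 1" using P_ge[of z] t by (intro divide_left_mono) auto
      also have "\<dots> \<le> t * (herglotz_const z * (\<Sum>n. (nrm (f n))\<^sup>2))"
        using V_le[of z] t by (simp add: mult_left_mono)
      finally show ?thesis by (simp add: mult.assoc)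
    qed
    fix g u assume g: "\<And>n. g n \<in> H" "summable (\<lambda>n. (nrm (g n))\<^sup>2)"
      and u: "\<And>x. (\<lambda>n. f n x * g n x) sums u x"
    have "pos_kernel (\<lambda>z w. of_real ((sqrt (1 / (2 * t)))\<^sup>2) * K z w
        - (\<Sum>k<N. (\<xi> z * f k z) * cnj (\<xi> w * f k w)) * K z w)" for N
    proof -
      let ?S = "\<lambda>z w. \<Sum>k<N. f k z * cnj (f k w)"
      have S: "(\<Sum>k<N. (\<xi> z * f k z) * cnj (\<xi> w * f k w)) = \<xi> z * cnj (\<xi> w) * ?S z w" for z w
        by (simp add: sum_distrib_left mult_ac)
      have sq: "(sqrt (1 / (2 * t)))\<^sup>2 = 1 / (2 * t)" using t by simp
      have "of_real (1 / (2 * t)) * (\<xi> z * cnj (\<xi> w) * (of_real (t\<^sup>2) * (V z * cnj (V w) * K z w) +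
          of_real (2 * t) * (K z w * ((V z + cnj (V w)) / 2 - ?S z w))) + \<xi> z * cnj (\<xi> w) * K z w)
        = of_real (1 / (2 * t)) * (\<xi> z * cnj (\<xi> w) * (P z * cnj (P w)) * K z w)
          - (of_real (1 / (2 * t)) * of_real (2 * t)) * (\<xi> z * cnj (\<xi> w) * ?S z w * K z w)" for z w
        unfolding P expand by (simp only: right_diff_distrib mult.assoc)
      moreover have "of_real (1 / (2 * t)) * of_real (2 * t) = (1 :: complex)" using t by simp
      moreover have "pos_kernel (\<lambda>z w. of_real (1 / (2 * t)) * (\<xi> z * cnj (\<xi> w) * (of_real (t\<^sup>2) * (V z * cnj (V w) * K z w) +
          of_real (2 * t) * (K z w * ((V z + cnj (V w)) / 2 - ?S z w))) + \<xi> z * cnj (\<xi> w) * K z w))"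
        by (intro pos_kernel_scale pos_kernel_add pos pos_kernel_rank_one schur_pos_imp_pos[OF schur_pos_K])
          (use t in auto)
      ultimately show ?thesis unfolding S sq \<xi>P by simp
    qed
    moreover have "(\<lambda>k. (\<xi> x * f k x) * g k x) sums (\<xi> x * u x)" for x
      using sums_mult[OF u] by (simp add: mult.assoc)
    ultimately show "\<xi> * u \<in> H \<and> nrm (\<xi> * u) \<le> sqrt (1 / (2 * t)) * sqrt (\<Sum>n. (nrm (g n))\<^sup>2)"
      using row_multiplier[of "sqrt (1 / (2 * t))" "\<lambda>k z. \<xi> z * f k z" g "\<lambda>x. \<xi> x * u x"] t g
      unfolding func_times by simp
  qed
qed

end


section \<open>Closures in the metric topologies\<close>

lemma norm_topology_closure:
  assumes "Metric_space B (norm_dist B nrm)"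
  shows "norm_topology B nrm closure_of S = {x \<in> B. \<forall>r>0. \<exists>y\<in>S \<inter> B. nrm (x - y) < r}"
proof -
  interpret Metric_space B "norm_dist B nrm" by (rule assms)
  have "(\<exists>y\<in>S. y \<in> mball x r) \<longleftrightarrow> (\<exists>y\<in>S \<inter> B. nrm (x - y) < r)" if "x \<in> B" for x r
    unfolding in_mball norm_dist_def using that by fastforce
  then show ?thesis
    unfolding norm_topology_def metric_closure_of by (simp only: cong: conj_cong)
qed

lemma closedin_norm_topology:
  assumes "Metric_space B (norm_dist B nrm)"
  shows "closedin (norm_topology B nrm) S \<longleftrightarrow>
    S \<subseteq> B \<and> (\<forall>x\<in>B. (\<forall>r>0. \<exists>y\<in>S. nrm (x - y) < r) \<longrightarrow> x \<in> S)"
proof -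
  interpret Metric_space B "norm_dist B nrm" by (rule assms)
  have "topspace (norm_topology B nrm) = B" by (simp add: norm_topology_def)
  then have "closedin (norm_topology B nrm) S \<longleftrightarrow> S \<subseteq> B \<and> norm_topology B nrm closure_of S \<subseteq> S"
    using closure_of_subset_eq[of S "norm_topology B nrm"] by simp
  moreover have "norm_topology B nrm closure_of S = {x \<in> B. \<forall>r>0. \<exists>y\<in>S. nrm (x - y) < r}" if "S \<subseteq> B"
    unfolding norm_topology_closure[OF assms] Int_absorb2[OF that] ..
  ultimately show ?thesis by blast
qed

section \<open>Multiplication on the weak product\<close>

context inner_product_function_space
begin

lemma nrm_minus: "f \<in> H \<Longrightarrow> nrm (- f) = nrm f"
  using nrm_scale[of f "-1"] unfolding fun_uminus_eq_scale by simp

text \<open>Moving a scalar from one factor to the other equalizes the norms. A summable series of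
  products of norms thus becomes two equal square sums, the form in which rows act.\<close>

lemma balanced_factors:
  assumes f: "f \<in> H" and g: "g \<in> H"
  shows "\<exists>f'\<in>H. \<exists>g'\<in>H. f' * g' = f * g \<and> (nrm f')\<^sup>2 = nrm f * nrm g \<and> (nrm g')\<^sup>2 = nrm f * nrm g"
proof (cases "nrm f = 0 \<or> nrm g = 0")
  case True
  then have "f = 0 \<or> g = 0" using nrm_zero_iff f g by blast
  then have "0 * 0 = f * g" by auto
  moreover have "nrm f * nrm g = 0" using True by auto
  ultimately show ?thesis
    by (intro bexI[of _ 0] conjI cfun.subspace_0[OF subspace]) (simp_all add: nrm_0)
next
  case False
  then have pos: "0 < nrm f" "0 < nrm g" using nrm_nonneg[OF f] nrm_nonneg[OF g] by auto
  define a where "a = sqrt (nrm g / nrm f)"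
  have a: "0 < a" "a\<^sup>2 = nrm g / nrm f" using pos by (simp_all add: a_def)
  let ?f = "fun_scale (of_real a) f" and ?g = "fun_scale (of_real (1 / a)) g"
  have "?f * ?g = f * g" using a(1) by (simp add: fun_eq_iff fun_scale_def)
  moreover have "(nrm ?f)\<^sup>2 = nrm f * nrm g"
  proof -
    have "(nrm ?f)\<^sup>2 = a\<^sup>2 * (nrm f)\<^sup>2" using a(1) by (simp add: nrm_scale f power_mult_distrib)
    then show ?thesis unfolding a(2) using pos by (simp add: power2_eq_square)
  qed
  moreover have "(nrm ?g)\<^sup>2 = nrm f * nrm g"
  proof -
    have "(nrm ?g)\<^sup>2 = (nrm g)\<^sup>2 / a\<^sup>2"
      unfolding nrm_scale[OF g] using a(1) by (simp add: power_mult_distrib power_divide norm_divide)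
    then show ?thesis unfolding a(2) using pos by (simp add: power2_eq_square)
  qed
  ultimately show ?thesis
    using cfun.subspace_scale[OF subspace f] cfun.subspace_scale[OF subspace g] by blast
qed

lemma balanced_rep:
  assumes h: "h \<in> W" and r: "Wnrm h < r"
  obtains f g where "\<And>n. f n \<in> H" "\<And>n. g n \<in> H" "summable (\<lambda>n. (nrm (f n))\<^sup>2)"
    "summable (\<lambda>n. (nrm (g n))\<^sup>2)" "(\<Sum>n. (nrm (f n))\<^sup>2) < r" "(\<Sum>n. (nrm (g n))\<^sup>2) < r"
    "\<And>x. (\<lambda>n. f n x * g n x) sums h x"
proof -
  obtain f g where rep: "weak_product_rep H nrm h f g" and less: "(\<Sum>n. nrm (f n) * nrm (g n)) < r"
    using Wnrm_greatest[OF h, of r] r by (meson not_le)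
  have fg: "\<And>n. f n \<in> H" "\<And>n. g n \<in> H" "summable (\<lambda>n. nrm (f n) * nrm (g n))"
    and sums: "\<And>x. (\<lambda>n. f n x * g n x) sums h x"
    using rep by (simp_all add: weak_product_rep_def)
  have "\<exists>p. fst p \<in> H \<and> snd p \<in> H \<and> fst p * snd p = f n * g n
      \<and> (nrm (fst p))\<^sup>2 = nrm (f n) * nrm (g n) \<and> (nrm (snd p))\<^sup>2 = nrm (f n) * nrm (g n)" for n
    using balanced_factors[OF fg(1,2), of n n] unfolding split_paired_Ex fst_conv snd_conv Bex_def by blast
  then have "\<exists>p. \<forall>n. fst (p n) \<in> H \<and> snd (p n) \<in> H \<and> fst (p n) * snd (p n) = f n * g n
      \<and> (nrm (fst (p n)))\<^sup>2 = nrm (f n) * nrm (g n) \<and> (nrm (snd (p n)))\<^sup>2 = nrm (f n) * nrm (g n)"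
    by (intro choice allI)
  then obtain p where p: "\<forall>n. fst (p n) \<in> H \<and> snd (p n) \<in> H \<and> fst (p n) * snd (p n) = f n * g n
      \<and> (nrm (fst (p n)))\<^sup>2 = nrm (f n) * nrm (g n) \<and> (nrm (snd (p n)))\<^sup>2 = nrm (f n) * nrm (g n)" ..
  then have "fst (p n) x * snd (p n) x = f n x * g n x" for n x
    by (metis times_fun_apply)
  then show ?thesis
    by (intro that[of "\<lambda>n. fst (p n)" "\<lambda>n. snd (p n)"]) (simp_all add: p fg less sums)
qed

lemma single_rep:
  assumes f: "f \<in> H" and g: "g \<in> H"
  defines "F \<equiv> \<lambda>n::nat. if n = 0 then f else 0" and "G \<equiv> \<lambda>n::nat. if n = 0 then g else 0"
  shows "F n \<in> H" "G n \<in> H" "(\<lambda>n. nrm (F n) * nrm (G n)) sums (nrm f * nrm g)"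
    "(\<lambda>n. (nrm (F n))\<^sup>2) sums (nrm f)\<^sup>2" "(\<lambda>n. F n x * G n x) sums (f * g) x"
proof -
  show "F n \<in> H" "G n \<in> H"
    using f g cfun.subspace_0[OF subspace] by (simp_all add: F_def G_def)
  have *: "(\<lambda>n::nat. if n = 0 then a else 0) sums a" for a :: "'c :: real_normed_vector"
    using sums_single[of 0 "\<lambda>_. a"] by simp
  have "(\<lambda>n. nrm (F n) * nrm (G n)) = (\<lambda>n. if n = 0 then nrm f * nrm g else 0)"
    by (rule ext) (simp add: F_def G_def nrm_0)
  then show "(\<lambda>n. nrm (F n) * nrm (G n)) sums (nrm f * nrm g)" by (simp only: *)
  have "(\<lambda>n. (nrm (F n))\<^sup>2) = (\<lambda>n. if n = 0 then (nrm f)\<^sup>2 else 0)"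
    by (rule ext) (simp add: F_def nrm_0)
  then show "(\<lambda>n. (nrm (F n))\<^sup>2) sums (nrm f)\<^sup>2" by (simp only: *)
  have "(\<lambda>n. F n x * G n x) = (\<lambda>n. if n = 0 then (f * g) x else 0)"
    by (rule ext) (simp add: F_def G_def)
  then show "(\<lambda>n. F n x * G n x) sums (f * g) x" by (simp only: *)
qed

lemma times_in_W:
  assumes f: "f \<in> H" and g: "g \<in> H"
  shows "f * g \<in> W" and "Wnrm (f * g) \<le> nrm f * nrm g"
proof -
  let ?F = "\<lambda>n::nat. if n = 0 then f else 0" and ?G = "\<lambda>n::nat. if n = 0 then g else 0"
  have rep: "weak_product_rep H nrm (f * g) ?F ?G"
    unfolding weak_product_rep_def
    by (intro conjI allI single_rep(1,2,5)[OF f g] sums_summable[OF single_rep(3)[OF f g]])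
  then show "f * g \<in> W" unfolding weak_product_def by blast
  show "Wnrm (f * g) \<le> nrm f * nrm g"
    unfolding sums_unique[OF single_rep(3)[OF f g]] by (rule Wnrm_le[OF rep])
qed

lemma Wnrm_diff_commute: "h \<in> W \<Longrightarrow> h' \<in> W \<Longrightarrow> Wnrm (h - h') = Wnrm (h' - h)"
  using Wnrm_minus[of "h' - h"] by (simp add: cfun.subspace_diff[OF W_subspace])

lemma Wnrm_triangle:
  "x \<in> W \<Longrightarrow> y \<in> W \<Longrightarrow> z \<in> W \<Longrightarrow> Wnrm (x - z) \<le> Wnrm (x - y) + Wnrm (y - z)"
  using Wnrm_add[of "x - y" "y - z"] by (simp add: cfun.subspace_diff[OF W_subspace])

lemma nrm_diff_le: "f \<in> H \<Longrightarrow> g \<in> H \<Longrightarrow> nrm (f - g) \<le> nrm f + nrm g"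
  using nrm_add[of f "- g"] by (simp add: nrm_minus cfun.subspace_neg[OF subspace])

end

section \<open>Bounded multipliers on the weak product\<close>

context rkhs_with_kernel
begin

lemma mult_boundD:
  "mult_bound C \<phi> \<Longrightarrow> f \<in> H \<Longrightarrow> \<phi> * f \<in> H"
  "mult_bound C \<phi> \<Longrightarrow> f \<in> H \<Longrightarrow> nrm (\<phi> * f) \<le> C * nrm f"
  "mult_bound C \<phi> \<Longrightarrow> 0 \<le> C"
  by (simp_all add: mult_bound_def)

lemma mult_bound_multiplier: "mult_bound C \<phi> \<Longrightarrow> \<phi> \<in> multipliers H"
  by (simp add: mult_bound_def multipliers_def)

lemma mult_bound_rep:
  assumes \<phi>: "mult_bound C \<phi>" and rep: "weak_product_rep H nrm h f g"
  shows "weak_product_rep H nrm (\<phi> * h) (\<lambda>n. \<phi> * f n) g"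
    and "(\<Sum>n. nrm (\<phi> * f n) * nrm (g n)) \<le> C * (\<Sum>n. nrm (f n) * nrm (g n))"
proof -
  have fg: "\<And>n. f n \<in> H" "\<And>n. g n \<in> H" "summable (\<lambda>n. nrm (f n) * nrm (g n))"
    and sums: "\<And>x. (\<lambda>n. f n x * g n x) sums h x"
    using rep by (simp_all add: weak_product_rep_def)
  have \<phi>f: "\<phi> * f n \<in> H" "nrm (\<phi> * f n) \<le> C * nrm (f n)" for n
    by (rule mult_boundD(1,2)[OF \<phi> fg(1)])+
  have le: "nrm (\<phi> * f n) * nrm (g n) \<le> C * (nrm (f n) * nrm (g n))" for n
    using mult_right_mono[OF \<phi>f(2) nrm_nonneg[OF fg(2)]] by (simp add: mult.assoc)
  have nonneg: "0 \<le> nrm (\<phi> * f n) * nrm (g n)" for n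
    by (intro mult_nonneg_nonneg nrm_nonneg \<phi>f fg)
  have summable: "summable (\<lambda>n. nrm (\<phi> * f n) * nrm (g n))"
    by (rule summable_comparison_test'[OF summable_mult[OF fg(3), of C], of 0])
      (simp only: real_norm_def abs_of_nonneg[OF nonneg] le)
  have "(\<lambda>n. (\<phi> * f n) x * g n x) sums (\<phi> * h) x" for x
    using sums_mult[OF sums, of "\<phi> x"] by (simp add: mult.assoc)
  then show "weak_product_rep H nrm (\<phi> * h) (\<lambda>n. \<phi> * f n) g"
    unfolding weak_product_rep_def by (intro conjI allI \<phi>f(1) fg(2) summable)
  show "(\<Sum>n. nrm (\<phi> * f n) * nrm (g n)) \<le> C * (\<Sum>n. nrm (f n) * nrm (g n))"
    unfolding suminf_mult[OF fg(3), symmetric]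
    by (rule suminf_le[OF le summable summable_mult[OF fg(3)]])
qed

lemma mult_bound_W:
  assumes \<phi>: "mult_bound C \<phi>" and h: "h \<in> W"
  shows "\<phi> * h \<in> W" and "Wnrm (\<phi> * h) \<le> C * Wnrm h"
proof -
  obtain f g where rep: "weak_product_rep H nrm h f g"
    using h unfolding weak_product_def by blast
  then show "\<phi> * h \<in> W" using mult_bound_rep(1)[OF \<phi>] unfolding weak_product_def by blast
  have le: "Wnrm (\<phi> * h) \<le> C * (\<Sum>n. nrm (f n) * nrm (g n))" if "weak_product_rep H nrm h f g" for f g
    using Wnrm_le[OF mult_bound_rep(1)[OF \<phi> that]] mult_bound_rep(2)[OF \<phi> that] by linarith
  show "Wnrm (\<phi> * h) \<le> C * Wnrm h"
  proof (cases "C = 0")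
    case True
    then show ?thesis using le[OF rep] by simp
  next
    case False
    then have C: "0 < C" using mult_boundD(3)[OF \<phi>] by simp
    have "Wnrm (\<phi> * h) / C \<le> Wnrm h"
      by (rule Wnrm_greatest[OF h]) (use le C in \<open>simp add: divide_le_eq mult.commute\<close>)
    then show ?thesis using C by (simp add: divide_le_eq mult.commute)
  qed
qed

lemma mult_bound_W_multiplier: "mult_bound C \<phi> \<Longrightarrow> \<phi> \<in> multipliers W"
  unfolding multipliers_def using mult_bound_W(1) by blast

text \<open>
  A contraction satisfies \<open>\<parallel>\<xi> f - f\<parallel>\<^sup>2 \<le> 2 Re \<langle>f - \<xi> f, f\<rangle>\<close>, so weak convergence, which follows from
  pointwise convergence and density of the kernels, implies strong convergence.
\<close>

lemma contractions_tendsto_H: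
  assumes \<xi>: "\<And>j. mult_bound 1 (\<xi> j)" and lim: "\<And>z. (\<lambda>j. \<xi> j z) \<longlonglongrightarrow> 1" and f: "f \<in> H"
  shows "(\<lambda>j. nrm (\<xi> j * f - f)) \<longlonglongrightarrow> 0"
proof -
  have \<xi>f: "\<xi> j * f \<in> H" "nrm (\<xi> j * f) \<le> nrm f" for j
    using mult_boundD(1,2)[OF \<xi> f] by simp_all
  have d: "f - \<xi> j * f \<in> H" "\<xi> j * f - f \<in> H" for j
    by (intro cfun.subspace_diff[OF subspace] f \<xi>f)+
  have d_le: "nrm (f - \<xi> j * f) \<le> 2 * nrm f" for j
    using nrm_diff_le[OF f \<xi>f(1), of j] \<xi>f(2)[of j] by linarith
  have sq: "(nrm (\<xi> j * f - f))\<^sup>2 \<le> 2 * Re (ip (f - \<xi> j * f) f)" for j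
  proof -
    have "(nrm (\<xi> j * f))\<^sup>2 \<le> (nrm f)\<^sup>2" by (rule power_mono[OF \<xi>f(2) nrm_nonneg[OF \<xi>f(1)]])
    then show ?thesis
      unfolding nrm_square_diff[OF \<xi>f(1) f] ip_diff[OF f \<xi>f(1) f] by (simp add: nrm_square[OF f, symmetric])
  qed
  have "(\<lambda>j. (nrm (\<xi> j * f - f))\<^sup>2) \<longlonglongrightarrow> 0"
  proof (rule tendstoI)
    fix e :: real assume e: "0 < e"
    \<comment> \<open>Chosen so that \<open>2 * nrm f * r \<le> e / 4\<close>; together with the
      \<open>e / 4\<close> from the kernels this is \<open>e / 2\<close>, which \<open>sq\<close>
      doubles. The 1 covers \<open>nrm f = 0\<close>.\<close>
    define r where "r = e / (8 * (nrm f + 1))"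
    have nf: "0 \<le> nrm f" by (rule nrm_nonneg[OF f])
    have r: "0 < r" using e nf by (simp add: r_def)
    obtain n c x where p: "nrm (f - comb n c x) < r" by (rule comb_dense[OF f r])
    let ?p = "comb n c x"
    have fp: "f - ?p \<in> H" by (rule cfun.subspace_diff[OF subspace f comb_in])
    have "(\<lambda>j. \<Sum>i<n. cnj (c i) * (f (x i) - \<xi> j (x i) * f (x i))) \<longlonglongrightarrow>
        (\<Sum>i<n. cnj (c i) * (f (x i) - 1 * f (x i)))"
      by (intro tendsto_intros lim)
    then have "(\<lambda>j. ip (f - \<xi> j * f) ?p) \<longlonglongrightarrow> 0"
      by (simp add: ip_comb[OF d(1)])
    then have "eventually (\<lambda>j. dist (ip (f - \<xi> j * f) ?p) 0 < e / 4) sequentially"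
      by (rule tendstoD) (use e in simp)
    then show "eventually (\<lambda>j. dist ((nrm (\<xi> j * f - f))\<^sup>2) 0 < e) sequentially"
    proof eventually_elim
      case (elim j)
      have "ip (f - \<xi> j * f) f = ip (f - \<xi> j * f) ?p + ip (f - \<xi> j * f) (f - ?p)"
        by (simp add: ip_diff_right[OF f comb_in d(1)])
      then have "Re (ip (f - \<xi> j * f) f) \<le> cmod (ip (f - \<xi> j * f) ?p) + cmod (ip (f - \<xi> j * f) (f - ?p))"
        by (metis complex_Re_le_cmod norm_triangle_ineq order_trans)
      moreover have "cmod (ip (f - \<xi> j * f) (f - ?p)) \<le> 2 * nrm f * r"
        by (rule order_trans[OF Cauchy_Schwarz[OF d(1) fp]])
          (intro mult_mono d_le less_imp_le[OF p] nrm_nonneg[OF fp], use nf in simp)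
      moreover have "2 * nrm f * r \<le> e / 4" using e nf by (simp add: r_def field_simps)
      ultimately have "Re (ip (f - \<xi> j * f) f) < e / 2"
        using elim by simp
      then show ?case using sq[of j] by simp
    qed
  qed
  then have "(\<lambda>j. sqrt ((nrm (\<xi> j * f - f))\<^sup>2)) \<longlonglongrightarrow> sqrt 0" by (rule tendsto_real_sqrt)
  then show ?thesis using nrm_nonneg[OF d(2)] by simp
qed

text \<open>Dominated convergence for series: each term tends to 0 by convergence in
  \<open>H\<close>, and contractivity bounds it by \<open>2 * (nrm (f n) * nrm (g n))\<close> for
  all \<open>j\<close>.\<close>

lemma contractions_tendsto_W:
  assumes \<xi>: "\<And>j. mult_bound 1 (\<xi> j)" and lim: "\<And>z. (\<lambda>j. \<xi> j z) \<longlonglongrightarrow> 1" and h: "h \<in> W"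
  shows "(\<lambda>j. Wnrm (\<xi> j * h - h)) \<longlonglongrightarrow> 0"
proof -
  obtain f g where rep: "weak_product_rep H nrm h f g" using h unfolding weak_product_def by blast
  have fg: "\<And>n. f n \<in> H" "\<And>n. g n \<in> H" "summable (\<lambda>n. nrm (f n) * nrm (g n))"
    and sums: "\<And>x. (\<lambda>n. f n x * g n x) sums h x"
    using rep by (simp_all add: weak_product_rep_def)
  have \<xi>f: "\<xi> j * f n \<in> H" "nrm (\<xi> j * f n) \<le> nrm (f n)" for j n
    using mult_boundD(1,2)[OF \<xi> fg(1)] by simp_all
  have d: "\<xi> j * f n - f n \<in> H" for j n by (intro cfun.subspace_diff[OF subspace] fg \<xi>f)
  define a where "a n j = nrm (\<xi> j * f n - f n) * nrm (g n)" for n j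
  have a0: "0 \<le> a n j" for n j unfolding a_def by (intro mult_nonneg_nonneg nrm_nonneg d fg)
  have a_le: "a n j \<le> 2 * (nrm (f n) * nrm (g n))" for n j
  proof -
    have "nrm (\<xi> j * f n - f n) \<le> 2 * nrm (f n)"
      using nrm_diff_le[OF \<xi>f(1) fg(1), of j n n] \<xi>f(2)[of j n] by linarith
    from mult_right_mono[OF this nrm_nonneg[OF fg(2)[of n]]] show ?thesis
      unfolding a_def by (simp only: mult.assoc)
  qed
  have norm_a: "norm (a n j) \<le> 2 * (nrm (f n) * nrm (g n))" for n j
    using a_le[of n j] a0[of n j] by simp
  have a_sum: "summable (\<lambda>n. a n j)" for j
    by (rule summable_comparison_test'[OF summable_mult[OF fg(3), of 2], of 0]) (rule norm_a)
  have "(\<lambda>j. \<Sum>n. a n j) \<longlonglongrightarrow> (\<Sum>n. 0 :: real)"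
  proof (rule tannerys_theorem[THEN conjunct2, THEN conjunct2])
    show "(\<lambda>j. a n j) \<longlonglongrightarrow> 0" for n
      unfolding a_def by (rule tendsto_mult_left_zero[OF contractions_tendsto_H[OF \<xi> lim fg(1)]])
    show "eventually (\<lambda>(n, j). norm (a n j) \<le> 2 * (nrm (f n) * nrm (g n))) (at_top \<times>\<^sub>F sequentially)"
      by (rule always_eventually) (simp only: split_paired_All split norm_a simp_thms)
    show "summable (\<lambda>n. 2 * (nrm (f n) * nrm (g n)))" by (rule summable_mult[OF fg(3)])
  qed simp
  then have tendsto: "(\<lambda>j. \<Sum>n. a n j) \<longlonglongrightarrow> 0" by simp
  have rep_j: "weak_product_rep H nrm (\<xi> j * h - h) (\<lambda>n. \<xi> j * f n - f n) g" for j
  proof -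
    have "(\<lambda>n. (\<xi> j * f n - f n) x * g n x) sums (\<xi> j * h - h) x" for x
      using sums_diff[OF sums_mult[OF sums[of x], of "\<xi> j x"] sums[of x]] by (simp add: algebra_simps)
    then show ?thesis
      unfolding weak_product_rep_def by (intro conjI allI d fg(2) a_sum[unfolded a_def])
  qed
  have "norm (Wnrm (\<xi> j * h - h)) \<le> (\<Sum>n. a n j)" for j
    using Wnrm_le[OF rep_j] Wnrm_nonneg[OF cfun.subspace_diff[OF W_subspace mult_bound_W(1)[OF \<xi> h] h]]
    unfolding a_def by simp
  then show ?thesis by (intro Lim_null_comparison[OF _ tendsto] always_eventually allI)
qed

end


context normalized_complete_pick_space
begin

lemma H_subset_W: "f \<in> H \<Longrightarrow> f \<in> W" and Wnrm_le_nrm: "f \<in> H \<Longrightarrow> Wnrm f \<le> nrm f"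
  using times_in_W[OF _ one_in, of f] by (simp_all only: nrm_one mult_1_right)

lemma multiplier_H_in: "\<phi> \<in> multipliers H \<Longrightarrow> \<phi> \<in> H"
  unfolding multipliers_def using bspec[OF _ one_in, of "\<lambda>f. \<phi> * f \<in> H"]
  by (simp only: mem_Collect_eq mult_1_right)

lemma multiplier_W_in: "\<phi> \<in> multipliers W \<Longrightarrow> \<phi> \<in> W"
  unfolding multipliers_def using bspec[OF _ H_subset_W[OF one_in], of "\<lambda>f. \<phi> * f \<in> W"]
  by (simp only: mem_Collect_eq mult_1_right)

text \<open>The pointwise limit 1 of the regularizers for \<open>t\<close> tending to 0 gives
  convergence on \<open>h\<close>, so one of them is close enough. Its constant \<open>C\<close>
  depends on \<open>r\<close> and may be large.\<close>

lemma regularize_row: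
  assumes f: "\<And>n. f n \<in> H" and summable: "summable (\<lambda>n. (nrm (f n))\<^sup>2)" and h: "h \<in> W" and r: "0 < r"
  obtains \<xi> C where "mult_bound 1 \<xi>" "Wnrm (\<xi> * h - h) < r" "0 \<le> C"
    "\<And>g u. (\<And>n. g n \<in> H) \<Longrightarrow> summable (\<lambda>n. (nrm (g n))\<^sup>2) \<Longrightarrow> (\<And>x. (\<lambda>n. f n x * g n x) sums u x)
      \<Longrightarrow> \<xi> * u \<in> H \<and> nrm (\<xi> * u) \<le> C * sqrt (\<Sum>n. (nrm (g n))\<^sup>2)"
proof -
  define t where "t j = 1 / real (Suc j)" for j
  define F where "F = (\<Sum>n. (nrm (f n))\<^sup>2)"
  define row where "row C \<xi> \<longleftrightarrow> (\<forall>g u. (\<forall>n. g n \<in> H) \<longrightarrow> summable (\<lambda>n. (nrm (g n))\<^sup>2) \<longrightarrow>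
    (\<forall>x. (\<lambda>n. f n x * g n x) sums u x) \<longrightarrow> \<xi> * u \<in> H \<and> nrm (\<xi> * u) \<le> C * sqrt (\<Sum>n. (nrm (g n))\<^sup>2))"
    for C \<xi>
  have t: "0 < t j" for j by (simp add: t_def)
  have "\<exists>\<xi>. mult_bound 1 \<xi> \<and> (\<forall>z. cmod (\<xi> z - 1) \<le> t j * (herglotz_const z * F)) \<and>
    row (sqrt (1 / (2 * t j))) \<xi>" for j
  proof (rule regularizer[OF f summable t[of j]])
    fix \<xi> assume *: "mult_bound 1 \<xi>" "\<And>z. cmod (\<xi> z - 1) \<le> t j * herglotz_const z * (\<Sum>n. (nrm (f n))\<^sup>2)"
      "\<And>g u. (\<And>n. g n \<in> H) \<Longrightarrow> summable (\<lambda>n. (nrm (g n))\<^sup>2) \<Longrightarrow> (\<And>x. (\<lambda>n. f n x * g n x) sums u x)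
        \<Longrightarrow> \<xi> * u \<in> H \<and> nrm (\<xi> * u) \<le> sqrt (1 / (2 * t j)) * sqrt (\<Sum>n. (nrm (g n))\<^sup>2)"
    have "row (sqrt (1 / (2 * t j))) \<xi>"
      unfolding row_def by (intro allI impI *(3)) simp_all
    then show ?thesis
      using *(1,2) unfolding F_def mult.assoc by blast
  qed
  then have "\<exists>\<xi>. \<forall>j. mult_bound 1 (\<xi> j) \<and> (\<forall>z. cmod (\<xi> j z - 1) \<le> t j * (herglotz_const z * F)) \<and>
    row (sqrt (1 / (2 * t j))) (\<xi> j)"
    by (intro choice allI)
  then obtain \<xi> where \<xi>: "\<And>j. mult_bound 1 (\<xi> j)"
    and close: "\<And>j z. cmod (\<xi> j z - 1) \<le> t j * (herglotz_const z * F)"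
    and row: "\<And>j. row (sqrt (1 / (2 * t j))) (\<xi> j)"
    by blast
  have t0: "t \<longlonglongrightarrow> 0"
    unfolding t_def by (rule LIMSEQ_inverse_real_of_nat[unfolded inverse_eq_divide])
  have "(\<lambda>j. \<xi> j z) \<longlonglongrightarrow> 1" for z
    by (rule LIM_zero_cancel, rule Lim_null_comparison[OF _ tendsto_mult_left_zero[OF t0, of "herglotz_const z * F"]])
      (intro always_eventually allI close)
  from order_tendstoD(2)[OF contractions_tendsto_W[OF \<xi> this h] r]
  obtain j where "Wnrm (\<xi> j * h - h) < r"
    using eventually_happens'[OF sequentially_bot] by blast
  moreover have "0 \<le> sqrt (1 / (2 * t j))" using t[of j] by simp
  ultimately show ?thesis
    using that[OF \<xi>[of j]] row[of j] unfolding row_def by blast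
qed

text \<open>Two elements appear because \<open>u\<close> is moved into \<open>H\<close> while the
  error is measured at another \<open>h\<close>; in applications \<open>u\<close> can be a
  multiplier and \<open>h\<close> its product with a vector.\<close>

lemma regularize_W:
  assumes u: "u \<in> W" and h: "h \<in> W" and r: "0 < r"
  obtains \<xi> where "mult_bound 1 \<xi>" "\<xi> * u \<in> H" "Wnrm (\<xi> * h - h) < r"
proof (rule balanced_rep[OF u less_add_one])
  fix f g assume fg: "\<And>n. f n \<in> H" "\<And>n. g n \<in> H" "summable (\<lambda>n. (nrm (f n))\<^sup>2)"
    "summable (\<lambda>n. (nrm (g n))\<^sup>2)" "\<And>x. (\<lambda>n. f n x * g n x) sums u x"
  show ?thesis
  proof (rule regularize_row[OF fg(1,3) h r])
    fix \<xi> C assume \<xi>: "mult_bound 1 \<xi>" "Wnrm (\<xi> * h - h) < r"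
      "\<And>g u. (\<And>n. g n \<in> H) \<Longrightarrow> summable (\<lambda>n. (nrm (g n))\<^sup>2) \<Longrightarrow> (\<And>x. (\<lambda>n. f n x * g n x) sums u x)
        \<Longrightarrow> \<xi> * u \<in> H \<and> nrm (\<xi> * u) \<le> C * sqrt (\<Sum>n. (nrm (g n))\<^sup>2)"
    show ?thesis by (rule that[OF \<xi>(1) conjunct1[OF \<xi>(3)[OF fg(2,4,5)]] \<xi>(2)])
  qed
qed

text \<open>The row with the single entry \<open>u\<close> becomes a bounded multiplier, so every
  element of \<open>H\<close> is a quotient of two bounded multipliers.\<close>

lemma regularize_H:
  assumes u: "u \<in> H" and h: "h \<in> W" and r: "0 < r"
  obtains \<xi> C where "mult_bound 1 \<xi>" "mult_bound C (\<xi> * u)" "Wnrm (\<xi> * h - h) < r"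
proof -
  let ?f = "\<lambda>n::nat. if n = 0 then u else 0"
  note single = single_rep[OF u]
  show ?thesis
  proof (rule regularize_row[OF single(1)[OF u] sums_summable[OF single(4)[OF u]] h r])
    fix \<xi> C assume \<xi>: "mult_bound 1 \<xi>" "Wnrm (\<xi> * h - h) < r" "0 \<le> C"
      and row: "\<And>g v. (\<And>n. g n \<in> H) \<Longrightarrow> summable (\<lambda>n. (nrm (g n))\<^sup>2) \<Longrightarrow> (\<And>x. (\<lambda>n. ?f n x * g n x) sums v x)
        \<Longrightarrow> \<xi> * v \<in> H \<and> nrm (\<xi> * v) \<le> C * sqrt (\<Sum>n. (nrm (g n))\<^sup>2)"
    have "mult_bound C (\<xi> * u)"
      unfolding mult_bound_def
    proof (intro conjI ballI \<xi>(3))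
      fix v assume v: "v \<in> H"
      let ?g = "\<lambda>n::nat. if n = 0 then v else 0"
      have *: "\<xi> * (u * v) \<in> H \<and> nrm (\<xi> * (u * v)) \<le> C * sqrt (\<Sum>n. (nrm (?g n))\<^sup>2)"
        by (rule row[OF single(2)[OF v] sums_summable[OF single_rep(4)[OF v v]] single(5)[OF v]])
      have "sqrt (\<Sum>n. (nrm (?g n))\<^sup>2) = nrm v"
        using nrm_nonneg[OF v] by (simp only: sums_unique[OF single_rep(4)[OF v v], symmetric] real_sqrt_abs abs_of_nonneg)
      then show "\<xi> * u * v \<in> H" "nrm (\<xi> * u * v) \<le> C * nrm v"
        using * by (simp_all only: mult.assoc)
    qed
    then show ?thesis by (rule that[OF \<xi>(1) _ \<xi>(2)])
  qed
qed

section \<open>The correspondence of invariant subspaces\<close>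

abbreviation (input) "inv_H \<equiv> closed_mult_invariant_subspaces H nrm"
abbreviation (input) "inv_W \<equiv> closed_mult_invariant_subspaces W Wnrm"
abbreviation (input) "cl M \<equiv> norm_topology W Wnrm closure_of M"

lemma inv_H_iff:
  "M \<in> inv_H \<longleftrightarrow> cfun.subspace M \<and> (M \<subseteq> H \<and> (\<forall>x\<in>H. (\<forall>r>0. \<exists>y\<in>M. nrm (x - y) < r) \<longrightarrow> x \<in> M)) \<and>
    (\<forall>\<phi>\<in>multipliers H. \<forall>f\<in>M. \<phi> * f \<in> M)"
  unfolding closed_mult_invariant_subspaces_def mem_Collect_eq
    closedin_norm_topology[OF Metric_space_ip_norm] ..

lemma inv_W_iff:
  "N \<in> inv_W \<longleftrightarrow> cfun.subspace N \<and> (N \<subseteq> W \<and> (\<forall>x\<in>W. (\<forall>r>0. \<exists>y\<in>N. Wnrm (x - y) < r) \<longrightarrow> x \<in> N)) \<and>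
    (\<forall>\<phi>\<in>multipliers W. \<forall>f\<in>N. \<phi> * f \<in> N)"
  unfolding closed_mult_invariant_subspaces_def mem_Collect_eq
    closedin_norm_topology[OF Metric_space_weak_product_norm] ..

lemma W_closure: "M \<subseteq> W \<Longrightarrow> cl M = {x \<in> W. \<forall>r>0. \<exists>y\<in>M. Wnrm (x - y) < r}"
  unfolding norm_topology_closure[OF Metric_space_weak_product_norm] by (simp only: Int_absorb2)

text \<open>For a multiplier \<phi> of \<open>H\<close> and \<open>f\<close> in \<open>N\<close>,
  \<open>\<xi> * \<phi>\<close> has a bound and thus multiplies the weak product as well. So
  \<open>\<xi> * (\<phi> * f)\<close> lies in \<open>N\<close> and approximates
  \<open>\<phi> * f\<close>.\<close>

lemma Int_H_closed_invariant:
  assumes N: "N \<in> inv_W"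
  shows "N \<inter> H \<in> inv_H"
proof -
  have sub: "cfun.subspace N" and NW: "N \<subseteq> W"
    and closed: "\<And>x. x \<in> W \<Longrightarrow> (\<And>r. 0 < r \<Longrightarrow> \<exists>y\<in>N. Wnrm (x - y) < r) \<Longrightarrow> x \<in> N"
    and inv: "\<And>\<phi> f. \<phi> \<in> multipliers W \<Longrightarrow> f \<in> N \<Longrightarrow> \<phi> * f \<in> N"
    using N unfolding inv_W_iff by blast+
  have 1: "x \<in> N" if x: "x \<in> H" and approx: "\<forall>r>0. \<exists>y\<in>N \<inter> H. nrm (x - y) < r" for x
  proof (rule closed[OF H_subset_W[OF x]])
    fix r :: real assume "0 < r"
    with approx obtain y where y: "y \<in> N" "y \<in> H" "nrm (x - y) < r" by blast
    from Wnrm_le_nrm[OF cfun.subspace_diff[OF subspace x y(2)]] y(3)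
    have "Wnrm (x - y) < r" by linarith
    then show "\<exists>y\<in>N. Wnrm (x - y) < r" using y(1) by blast
  qed
  have \<phi>f: "\<phi> * f \<in> H" if "\<phi> \<in> multipliers H" "f \<in> H" for \<phi> f
    using that unfolding multipliers_def by blast
  have 2: "\<phi> * f \<in> N" if \<phi>: "\<phi> \<in> multipliers H" and f: "f \<in> N" "f \<in> H" for \<phi> f
  proof (rule closed)
    show W: "\<phi> * f \<in> W" by (rule H_subset_W[OF \<phi>f[OF \<phi> f(2)]])
    fix r :: real assume r: "0 < r"
    obtain \<xi> C where \<xi>: "mult_bound 1 \<xi>" "mult_bound C (\<xi> * \<phi>)" "Wnrm (\<xi> * (\<phi> * f) - \<phi> * f) < r"
      by (rule regularize_H[OF multiplier_H_in[OF \<phi>] W r])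
    have "\<xi> * (\<phi> * f) \<in> N"
      using inv[OF mult_bound_W_multiplier[OF \<xi>(2)] f(1)] by (simp only: mult.assoc)
    moreover have "Wnrm (\<phi> * f - \<xi> * (\<phi> * f)) < r"
      unfolding Wnrm_diff_commute[OF W mult_bound_W(1)[OF \<xi>(1) W]] by (rule \<xi>(3))
    ultimately show "\<exists>y\<in>N. Wnrm (\<phi> * f - y) < r" by blast
  qed
  show ?thesis
    unfolding inv_H_iff using cfun.subspace_inter[OF sub subspace] 1 2 \<phi>f by blast
qed

text \<open>Invariance of the closure is immediate only for multipliers with a bound on
  \<open>H\<close>. A multiplier \<phi> of the weak product is merely known to lie in it and is
  regularized twice: \<xi> brings it into \<open>H\<close>, then \<eta> makes it a bounded
  multiplier.\<close>

lemma closure_closed_invariant: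
  assumes M: "M \<in> inv_H"
  shows "cl M \<in> inv_W"
proof -
  have sub: "cfun.subspace M" and MH: "M \<subseteq> H"
    and inv: "\<And>\<phi> f. \<phi> \<in> multipliers H \<Longrightarrow> f \<in> M \<Longrightarrow> \<phi> * f \<in> M"
    using M unfolding inv_H_iff by blast+
  have MW: "m \<in> W" if "m \<in> M" for m using that MH H_subset_W by blast
  define L where "L = cl M"
  have L_eq: "L = {x \<in> W. \<forall>r>0. \<exists>y\<in>M. Wnrm (x - y) < r}"
    unfolding L_def by (rule W_closure) (use MW in blast)
  have LI: "x \<in> L" if "x \<in> W" "\<And>r. 0 < r \<Longrightarrow> \<exists>y\<in>M. Wnrm (x - y) < r" for x
    using that unfolding L_eq by blast
  have LW: "x \<in> W" if "x \<in> L" for x using that unfolding L_eq by blast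
  have LD: "\<exists>y\<in>M. Wnrm (x - y) < r" if "x \<in> L" "0 < r" for x r
    using that unfolding L_eq by blast
  have closed: "x \<in> L" if x: "x \<in> W" and approx: "\<And>r. 0 < r \<Longrightarrow> \<exists>y\<in>L. Wnrm (x - y) < r" for x
  proof (rule LI[OF x])
    fix r :: real assume r: "0 < r"
    then have r2: "0 < r / 2" by simp
    obtain y where y: "y \<in> L" "Wnrm (x - y) < r / 2" using approx[OF r2] by blast
    obtain m where m: "m \<in> M" "Wnrm (y - m) < r / 2" using LD[OF y(1) r2] by blast
    have "Wnrm (x - m) < r"
      using Wnrm_triangle[OF x LW[OF y(1)] MW[OF m(1)]] m(2) y(2) by linarith
    then show "\<exists>y\<in>M. Wnrm (x - y) < r" using m(1) by blast
  qed
  have bounded: "\<theta> * x \<in> L" if \<theta>: "mult_bound C \<theta>" and x: "x \<in> L" for \<theta> C x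
  proof (rule LI)
    show "\<theta> * x \<in> W" by (rule mult_bound_W(1)[OF \<theta> LW[OF x]])
    fix r :: real assume r: "0 < r"
    have C: "0 \<le> C" by (rule mult_boundD(3)[OF \<theta>])
    then have "0 < r / (C + 1)" using r by simp
    from LD[OF x this] obtain m where m: "m \<in> M" "Wnrm (x - m) < r / (C + 1)" by blast
    have "Wnrm (\<theta> * (x - m)) \<le> C * Wnrm (x - m)"
      by (rule mult_bound_W(2)[OF \<theta> cfun.subspace_diff[OF W_subspace LW[OF x] MW[OF m(1)]]])
    also have "\<dots> \<le> C * (r / (C + 1))" using m C by (intro mult_left_mono) auto
    also have "\<dots> < r" using C r by (simp add: field_simps)
    finally show "\<exists>y\<in>M. Wnrm (\<theta> * x - y) < r"
      using inv[OF mult_bound_multiplier[OF \<theta>] m(1)] unfolding right_diff_distrib by blast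
  qed
  have sub_L: "cfun.subspace L"
  proof (rule cfun.subspaceI)
    have "Wnrm (0 - 0) = 0"
      using Wnrm_zero_iff[OF cfun.subspace_0[OF W_subspace]] by simp
    then show "0 \<in> L"
      using cfun.subspace_0[OF sub] by (intro LI cfun.subspace_0[OF W_subspace] bexI[of _ 0]) simp_all
    fix x y assume x: "x \<in> L" and y: "y \<in> L"
    show "x + y \<in> L"
    proof (rule LI)
      show "x + y \<in> W" by (rule cfun.subspace_add[OF W_subspace LW[OF x] LW[OF y]])
      fix r :: real assume "0 < r"
      then have r2: "0 < r / 2" by simp
      obtain m where m: "m \<in> M" "Wnrm (x - m) < r / 2" using LD[OF x r2] by blast
      obtain m' where m': "m' \<in> M" "Wnrm (y - m') < r / 2" using LD[OF y r2] by blast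
      have "Wnrm ((x - m) + (y - m')) \<le> Wnrm (x - m) + Wnrm (y - m')"
        by (intro Wnrm_add cfun.subspace_diff[OF W_subspace] LW x y MW m m')
      then have "Wnrm (x + y - (m + m')) < r"
        using m(2) m'(2) by (simp only: add_diff_add)
      then show "\<exists>z\<in>M. Wnrm (x + y - z) < r" using cfun.subspace_add[OF sub m(1) m'(1)] by blast
    qed
  next
    fix c x assume x: "x \<in> L"
    have eq: "fun_scale c f = (\<lambda>_. c) * f" for f :: "'a \<Rightarrow> complex" by (simp add: fun_scale_def fun_eq_iff)
    have "mult_bound (cmod c) (\<lambda>_. c)"
      unfolding mult_bound_def eq[symmetric] using cfun.subspace_scale[OF subspace] nrm_scale by simp
    from bounded[OF this x] show "fun_scale c x \<in> L" unfolding eq .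
  qed
  have inv_L: "\<phi> * x \<in> L" if \<phi>: "\<phi> \<in> multipliers W" and x: "x \<in> L" for \<phi> x
  proof (rule closed)
    show \<phi>x: "\<phi> * x \<in> W" using \<phi> LW[OF x] unfolding multipliers_def by blast
    fix r :: real assume "0 < r"
    then have r2: "0 < r / 2" by simp
    obtain \<xi> where \<xi>: "mult_bound 1 \<xi>" "\<xi> * \<phi> \<in> H" "Wnrm (\<xi> * (\<phi> * x) - \<phi> * x) < r / 2"
      by (rule regularize_W[OF multiplier_W_in[OF \<phi>] \<phi>x r2])
    have \<xi>\<phi>x: "\<xi> * (\<phi> * x) \<in> W" by (rule mult_bound_W(1)[OF \<xi>(1) \<phi>x])
    obtain \<eta> C where \<eta>: "mult_bound 1 \<eta>" "mult_bound C (\<eta> * (\<xi> * \<phi>))"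
      "Wnrm (\<eta> * (\<xi> * (\<phi> * x)) - \<xi> * (\<phi> * x)) < r / 2"
      by (rule regularize_H[OF \<xi>(2) \<xi>\<phi>x r2])
    have \<eta>\<xi>\<phi>x: "\<eta> * (\<xi> * (\<phi> * x)) \<in> W" by (rule mult_bound_W(1)[OF \<eta>(1) \<xi>\<phi>x])
    have "Wnrm (\<phi> * x - \<eta> * (\<xi> * (\<phi> * x))) < r"
      using Wnrm_triangle[OF \<phi>x \<xi>\<phi>x \<eta>\<xi>\<phi>x] \<xi>(3) \<eta>(3)
        Wnrm_diff_commute[OF \<phi>x \<xi>\<phi>x] Wnrm_diff_commute[OF \<xi>\<phi>x \<eta>\<xi>\<phi>x] by linarith
    moreover have "\<eta> * (\<xi> * (\<phi> * x)) \<in> L" using bounded[OF \<eta>(2) x] by (simp only: mult.assoc)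
    ultimately show "\<exists>y\<in>L. Wnrm (\<phi> * x - y) < r" by blast
  qed
  show ?thesis
    unfolding inv_W_iff L_def[symmetric] using sub_L LW closed inv_L by blast
qed

lemma closure_Int_H:
  assumes M: "M \<in> inv_H"
  shows "cl M \<inter> H = M"
proof -
  have MH: "M \<subseteq> H"
    and closed: "\<And>x. x \<in> H \<Longrightarrow> (\<And>r. 0 < r \<Longrightarrow> \<exists>y\<in>M. nrm (x - y) < r) \<Longrightarrow> x \<in> M"
    and inv: "\<And>\<phi> f. \<phi> \<in> multipliers H \<Longrightarrow> f \<in> M \<Longrightarrow> \<phi> * f \<in> M"
    using M unfolding inv_H_iff by blast+
  have MW: "M \<subseteq> W" using MH H_subset_W by blast
  have "topspace (norm_topology W Wnrm) = W"
    unfolding norm_topology_def by (rule Metric_space.topspace_mtopology[OF Metric_space_weak_product_norm])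
  then have 1: "M \<subseteq> cl M" using MW by (intro closure_of_subset) simp
  define \<delta> where "\<delta> j = 1 / real (Suc j)" for j
  have \<delta>_pos: "0 < \<delta> j" for j by (simp add: \<delta>_def)
  have \<delta>: "\<delta> \<longlonglongrightarrow> 0"
    unfolding \<delta>_def by (rule LIMSEQ_inverse_real_of_nat[unfolded inverse_eq_divide])
  have 2: "f \<in> M" if f: "f \<in> cl M" "f \<in> H" for f
  proof -
    have "\<exists>p. fst p \<in> M \<and> mult_bound 1 (snd p) \<and> (\<forall>z. cmod (snd p z - 1) \<le> herglotz_const z * \<delta> j) \<and>
      nrm (snd p * (f - fst p)) \<le> sqrt (\<delta> j)" for j
    proof -
      obtain m where m: "m \<in> M" "Wnrm (f - m) < \<delta> j"
        using f(1) \<delta>_pos[of j] unfolding W_closure[OF MW] by blast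
      have "m \<in> W" using m(1) MW by blast
      then have fm: "f - m \<in> W"
        by (rule cfun.subspace_diff[OF W_subspace H_subset_W[OF f(2)]])
      show ?thesis
      proof (rule balanced_rep[OF fm m(2)])
        fix p g assume pg: "\<And>n. p n \<in> H" "\<And>n. g n \<in> H" "summable (\<lambda>n. (nrm (p n))\<^sup>2)"
          "summable (\<lambda>n. (nrm (g n))\<^sup>2)" "(\<Sum>n. (nrm (p n))\<^sup>2) < \<delta> j" "(\<Sum>n. (nrm (g n))\<^sup>2) < \<delta> j"
          "\<And>x. (\<lambda>n. p n x * g n x) sums (f - m) x"
        show ?thesis
        \<comment> \<open>With \<open>t = 1\<close> both estimates depend only on square sums below
          \<open>\<delta> j\<close>; a shrinking \<open>t\<close> would enlarge the factor
          \<open>sqrt (1 / (2 * t))\<close>.\<close>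
        proof (rule regularizer[OF pg(1,3) zero_less_one])
          fix \<xi> assume \<xi>: "mult_bound 1 \<xi>"
            "\<And>z. cmod (\<xi> z - 1) \<le> 1 * herglotz_const z * (\<Sum>n. (nrm (p n))\<^sup>2)"
            "\<And>g u. (\<And>n. g n \<in> H) \<Longrightarrow> summable (\<lambda>n. (nrm (g n))\<^sup>2) \<Longrightarrow> (\<And>x. (\<lambda>n. p n x * g n x) sums u x)
              \<Longrightarrow> \<xi> * u \<in> H \<and> nrm (\<xi> * u) \<le> sqrt (1 / (2 * 1)) * sqrt (\<Sum>n. (nrm (g n))\<^sup>2)"
          have a: "cmod (\<xi> z - 1) \<le> herglotz_const z * \<delta> j" for z
            using \<xi>(2)[of z] mult_left_mono[OF less_imp_le[OF pg(5)] herglotz_const_nonneg[of z]] by linarith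
          have "nrm (\<xi> * (f - m)) \<le> sqrt (1 / (2 * 1)) * sqrt (\<Sum>n. (nrm (g n))\<^sup>2)"
            by (rule conjunct2[OF \<xi>(3)[OF pg(2,4,7)]])
          also have "\<dots> \<le> 1 * sqrt (\<delta> j)"
            using pg(6) suminf_nonneg[OF pg(4)] by (intro mult_mono) auto
          finally have b: "nrm (\<xi> * (f - m)) \<le> sqrt (\<delta> j)" by simp
          show ?thesis
            by (intro exI[of _ "(m, \<xi>)"]) (simp only: fst_conv snd_conv m(1) \<xi>(1) a b simp_thms)
        qed
      qed
    qed
    then have "\<exists>p. \<forall>j. fst (p j) \<in> M \<and> mult_bound 1 (snd (p j)) \<and>
      (\<forall>z. cmod (snd (p j) z - 1) \<le> herglotz_const z * \<delta> j) \<and> nrm (snd (p j) * (f - fst (p j))) \<le> sqrt (\<delta> j)"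
      by (intro choice allI)
    then obtain p where p: "\<forall>j. fst (p j) \<in> M \<and> mult_bound 1 (snd (p j)) \<and>
      (\<forall>z. cmod (snd (p j) z - 1) \<le> herglotz_const z * \<delta> j) \<and> nrm (snd (p j) * (f - fst (p j))) \<le> sqrt (\<delta> j)" ..
    define m where "m j = fst (p j)" for j
    define \<xi> where "\<xi> j = snd (p j)" for j
    have m: "m j \<in> M" and \<xi>: "mult_bound 1 (\<xi> j)"
      and close: "cmod (\<xi> j z - 1) \<le> herglotz_const z * \<delta> j"
      and small: "nrm (\<xi> j * (f - m j)) \<le> sqrt (\<delta> j)" for j z
      using p by (simp_all add: m_def \<xi>_def)
    have "(\<lambda>j. \<xi> j z) \<longlonglongrightarrow> 1" for z
      by (rule LIM_zero_cancel, rule Lim_null_comparison[OF _ tendsto_mult_right_zero[OF \<delta>, of "herglotz_const z"]])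
        (intro always_eventually allI close)
    from contractions_tendsto_H[OF \<xi> this f(2)]
    have "(\<lambda>j. nrm (\<xi> j * f - f) + sqrt (\<delta> j)) \<longlonglongrightarrow> 0 + sqrt 0"
      by (intro tendsto_add tendsto_real_sqrt \<delta>)
    then have lim: "(\<lambda>j. nrm (\<xi> j * f - f) + sqrt (\<delta> j)) \<longlonglongrightarrow> 0" by simp
    show ?thesis
    proof (rule closed[OF f(2)])
      fix r :: real assume "0 < r"
      then obtain j where j: "nrm (\<xi> j * f - f) + sqrt (\<delta> j) < r"
        using eventually_happens'[OF sequentially_bot order_tendstoD(2)[OF lim]] by blast
      have mH: "m j \<in> H" using m MH by blast
      have \<xi>f: "\<xi> j * f \<in> H" by (rule mult_boundD(1)[OF \<xi> f(2)])
      \<comment> \<open>The approximants in \<open>M\<close> are \<open>\<xi> j * m j\<close>; the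
        \<open>m j\<close> themselves need not converge in \<open>H\<close>.\<close>
      have "nrm ((f - \<xi> j * f) + \<xi> j * (f - m j)) \<le> nrm (f - \<xi> j * f) + nrm (\<xi> j * (f - m j))"
        by (intro nrm_add cfun.subspace_diff[OF subspace] mult_boundD(1)[OF \<xi>] f(2) mH)
      also have "(f - \<xi> j * f) + \<xi> j * (f - m j) = f - \<xi> j * m j"
        by (simp add: right_diff_distrib)
      also have "nrm (f - \<xi> j * f) = nrm (\<xi> j * f - f)"
        by (rule nrm_diff_commute[OF f(2) \<xi>f])
      finally have "nrm (f - \<xi> j * m j) < r" using small[of j] j by linarith
      then show "\<exists>y\<in>M. nrm (f - y) < r" using inv[OF mult_bound_multiplier[OF \<xi>] m] by blast
    qed
  qed
  show ?thesis using 1 2 MH by blast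
qed

text \<open>For \<open>h\<close> in \<open>N\<close>, the regularizations \<open>\<xi> * h\<close>
  stay in \<open>N\<close>, lie in \<open>H\<close> and approximate \<open>h\<close>.\<close>

lemma Int_H_closure:
  assumes N: "N \<in> inv_W"
  shows "cl (N \<inter> H) = N"
proof -
  have NW: "N \<subseteq> W"
    and closed: "\<And>x. x \<in> W \<Longrightarrow> (\<And>r. 0 < r \<Longrightarrow> \<exists>y\<in>N. Wnrm (x - y) < r) \<Longrightarrow> x \<in> N"
    and inv: "\<And>\<phi> f. \<phi> \<in> multipliers W \<Longrightarrow> f \<in> N \<Longrightarrow> \<phi> * f \<in> N"
    using N unfolding inv_W_iff by blast+
  have cl: "cl (N \<inter> H) = {x \<in> W. \<forall>r>0. \<exists>y\<in>N \<inter> H. Wnrm (x - y) < r}"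
    by (rule W_closure) (use NW in blast)
  have 1: "\<exists>y\<in>N \<inter> H. Wnrm (h - y) < r" if h: "h \<in> N" and r: "0 < r" for h r
  proof -
    have hW: "h \<in> W" using h NW by blast
    obtain \<xi> where \<xi>: "mult_bound 1 \<xi>" "\<xi> * h \<in> H" "Wnrm (\<xi> * h - h) < r"
      by (rule regularize_W[OF hW hW r])
    have "Wnrm (h - \<xi> * h) < r"
      unfolding Wnrm_diff_commute[OF hW mult_bound_W(1)[OF \<xi>(1) hW]] by (rule \<xi>(3))
    then show ?thesis using inv[OF mult_bound_W_multiplier[OF \<xi>(1)] h] \<xi>(2) by blast
  qed
  have 2: "x \<in> N" if "x \<in> W" "\<forall>r>0. \<exists>y\<in>N \<inter> H. Wnrm (x - y) < r" for x
    by (rule closed[OF that(1)]) (use that(2) in blast)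
  show ?thesis unfolding cl using 1 2 NW by blast
qed

end

theorem theorem1p5:
  fixes H :: "('a \<Rightarrow> complex) set"
    and ip :: "('a \<Rightarrow> complex) \<Rightarrow> ('a \<Rightarrow> complex) \<Rightarrow> complex"
    and K :: "'a \<Rightarrow> 'a \<Rightarrow> complex"
  assumes "normalized_complete_pick_space H ip K"
  defines "HH \<equiv> weak_product H (ip_norm ip)"
    and "HHnorm \<equiv> weak_product_norm H (ip_norm ip)"
  defines "\<A> \<equiv> closed_mult_invariant_subspaces H (ip_norm ip)"
    and "\<B> \<equiv> closed_mult_invariant_subspaces HH HHnorm"
  shows "bij_betw (\<lambda>M. norm_topology HH HHnorm closure_of M) \<A> \<B>
       \<and> bij_betw (\<lambda>N. N \<inter> H) \<B> \<A>
       \<and> (\<forall>M\<in>\<A>. (norm_topology HH HHnorm closure_of M) \<inter> H = M)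
       \<and> (\<forall>N\<in>\<B>. norm_topology HH HHnorm closure_of (N \<inter> H) = N)"
proof -
  interpret normalized_complete_pick_space H ip K by (rule assms(1))
  have 1: "\<forall>M\<in>\<A>. (norm_topology HH HHnorm closure_of M) \<inter> H = M"
    and 2: "\<forall>N\<in>\<B>. norm_topology HH HHnorm closure_of (N \<inter> H) = N"
    and 3: "(\<lambda>M. norm_topology HH HHnorm closure_of M) ` \<A> \<subseteq> \<B>"
    and 4: "(\<lambda>N. N \<inter> H) ` \<B> \<subseteq> \<A>"
    unfolding HH_def HHnorm_def \<A>_def \<B>_def
    using closure_Int_H Int_H_closure closure_closed_invariant Int_H_closed_invariant by blast+
  show ?thesis
    by (intro conjI bij_betw_byWitness[OF 1 2 3 4] bij_betw_byWitness[OF 2 1 4 3] 1 2)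
qed

end
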